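(* Let $(\mathsf{X},\mathsf{d})$ be a proper metric space (every closed ball is compact). For each $n\in\mathbb{N}\cup\{\infty\}$ let $X_n$ be a nonempty subset of $\mathsf{X}$ (not necessarily compact), equipped with the intrinsic (length) metric $d_n$ induced from $\mathsf{d}$, and assume that $(X_n,d_n)$ is a complete geodesic space. Let $H_n: X_n\times\mathbb{R}\times\mathbb{R}_+\to\mathbb{R}$ for $n\in\mathbb{N}\cup\{\infty\}$. For $x\in X_\infty$ let $S(x)$ be the set of sequences $(x_n)_{n\in\mathbb{N}}$ with $x_n\in X_n$ for all $n$ and $\mathsf{d}(x_n,x)\to 0$. Write $B(a,r;X_n)=\{x\in X_n: d_n(a,x)\le r\}$. Assume: (1) $\max\{\sup_{x\in X_n}\mathsf{d}(X_\infty,x),\ \sup_{x\in X_\infty}\mathsf{d}(X_n,x)\}\to 0$ as $n\to\infty$, where $\mathsf{d}(A,x)=\inf_{a\in A}\mathsf{d}(a,x)$; (2) for all $a_\infty,b_\infty\in X_\infty$, $(a_n)\in S(a_\infty)$ and $(b_n)\in S(b_\infty)$ one has $d_n(a_n,b_n)\to d_\infty(a_\infty,b_\infty)$; (3) for all $x_\infty\in X_\infty$, $(x_n)\in S(x_\infty)$, $u_n\to u_\infty$ in $\mathbb{R}$ and $p_n\to p_\infty$ in $\mathbb{R}_+$ one has $H_n(x_n,u_n,p_n)\to H_\infty(x_\infty,u_\infty,p_\infty)$. Then the following hold. (a) Assume in addition that for every $a_\infty\in X_\infty$, every $(a_n)\in S(a_\infty)$, and all upper semicontinuous functions $\phi_n:X_n\to\mathbb{R}$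 ($n\in\mathbb{N}$) and $\phi_\infty:X_\infty\to\mathbb{R}$ such that $\limsup_n\phi_n(x_n)\le\phi_\infty(x_\infty)$ for all $x_\infty\in X_\infty$ and $(x_n)\in S(x_\infty)$, there exists $\delta>0$ such that $$\limsup_{n}\sup_{B(a_n,r;X_n)}\phi_n\le\sup_{B(a_\infty,r;X_\infty)}\phi_\infty\quad\text{for all } 0<r<\delta.$$ Let $u^n:X_n\to\mathbb{R}$ be a metric viscosity subsolution of $H_n(x,u^n(x),|\nabla_{d_n}u^n|(x))=0$ on $(X_n,d_n)$ for each $n\in\mathbb{N}$. If the upper semilimit $\overline{u}^\infty(x):=\sup_{(x_n)\in S(x)}\limsup_{n\to\infty}u^n(x_n)$, $x\in X_\infty$, is real-valued and upper semicontinuous with respect to $d_\infty$, then $\overline{u}^\infty$ is a metric viscosity subsolution of $H_\infty(x,u(x),|\nabla_{d_\infty}u|(x))=0$ on $(X_\infty,d_\infty)$. (b) Assume, in addition to (1)--(3), that for every $a_\infty\in X_\infty$, every $(a_n)\in S(a_\infty)$, and all lower semicontinuous functions $\phi_n:X_n\to\mathbb{R}$ ($n\in\mathbb{N}$) and $\phi_\infty:X_\infty\to\mathbb{R}$ such that $\liminf_n\phi_n(x_n)\ge\phi_\infty(x_\infty)$ for all $x_\infty\in X_\infty$ and $(x_n)\in S(x_\infty)$, there exists $\delta>0$ such that $$\liminf_{n}\inf_{B(a_n,r;X_n)}\phi_n\ge\inf_{B(a_\infty,r;X_\infty)}\phi_\infty\quad\text{for all } 0<r<\delta.$$ Let $u^n:X_n\to\mathbb{R}$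 be a metric viscosity supersolution of $H_n(x,u^n(x),|\nabla_{d_n}u^n|(x))=0$ on $(X_n,d_n)$ for each $n\in\mathbb{N}$. If the lower semilimit $\underline{u}^\infty(x):=\inf_{(x_n)\in S(x)}\liminf_{n\to\infty}u^n(x_n)$, $x\in X_\infty$, is real-valued and lower semicontinuous with respect to $d_\infty$, then $\underline{u}^\infty$ is a metric viscosity supersolution of $H_\infty(x,u(x),|\nabla_{d_\infty}u|(x))=0$ on $(X_\infty,d_\infty)$.
   Context: $\mathbb{R}_+=[0,\infty)$. Semicontinuity of functions on $X_n$ is with respect to $d_n$. Let $(X,d)$ be a complete geodesic space and $H:X\times\mathbb{R}\times\mathbb{R}_+\to\mathbb{R}$. All topological notions on $X$ (local maxima, semicontinuity, envelopes, local Lipschitz continuity) are with respect to $d$. Slopes. For a locally Lipschitz $u:X\to\mathbb{R}$, $$|\nabla_d u|(x)=\limsup_{y\to x}\frac{|u(y)-u(x)|}{d(x,y)},\qquad |\nabla_d^{\pm}u|(x)=\limsup_{y\to x}\frac{[u(y)-u(x)]_\pm}{d(x,y)},$$ with $[a]_\pm=\max\{\pm a,0\}$ (and value $0$ at an isolated point). A locally Lipschitz $u$ is $C^{1,+}$ (resp. $C^{1,-}$) if $|\nabla_d u|$ is continuous and $|\nabla_d^{+}u|=|\nabla_d u|$ (resp. $|\nabla_d^{-}u|=|\nabla_d u|$) everywhere. Envelopes. $u^*$ and $u_*$ are the upper and lower semicontinuous envelopes of $u$; $|\nabla_d\psi|^*$ is the upper semicontinuous envelope of $|\nabla_d\psi|$.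 For subsolutions $u^*$ is understood to be real-valued, for supersolutions $u_*$ is understood to be real-valued. Modified Hamiltonians. For $a\ge 0$, $H_a(x,u,p)=\inf\{H(x,u,p'):p'\ge0,\ |p'-p|\le a\}$ and $H^a(x,u,p)=\sup\{H(x,u,p'):p'\ge0,\ |p'-p|\le a\}$. Test functions. $\psi=\psi_1+\psi_2$ is a test function for subsolutions (resp. supersolutions) if $\psi_1$ is $C^{1,-}$ (resp. $C^{1,+}$) and $\psi_2$ is locally Lipschitz on $X$. Metric viscosity solutions of $H(x,u(x),|\nabla_d u|(x))=0$ on $X$. A function $u:X\to\mathbb{R}$ is a metric viscosity subsolution if, for every test function $\psi=\psi_1+\psi_2$ for subsolutions such that $u^*-\psi$ attains a local maximum at $\hat x\in X$, one has $H_{|\nabla_d\psi_2|^*(\hat x)}(\hat x,u^*(\hat x),|\nabla_d\psi_1|(\hat x))\le 0$. It is a metric viscosity supersolution if, for every test function $\psi=\psi_1+\psi_2$ for supersolutions such that $u_*-\psi$ attains a local minimum at $\hat x\in X$, one has $H^{|\nabla_d\psi_2|^*(\hat x)}(\hat x,u_*(\hat x),|\nabla_d\psi_1|(\hat x))\ge 0$. *)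

theory Defs
  imports "HOL-Analysis.Analysis" "HOL-Library.Extended_Nat"
begin

subsection \<open>Intrinsic metrics and geodesic spaces\<close>

definition curve_length :: "(real \<Rightarrow> 'a::metric_space) \<Rightarrow> ennreal" where
  "curve_length g =
     (SUP ts \<in> {ts. sorted ts \<and> set ts \<subseteq> {0..1}}.
        \<Sum>i<length ts - 1. ennreal (dist (g (ts ! i)) (g (ts ! Suc i))))"

definition intrinsic_edist :: "'a::metric_space set \<Rightarrow> 'a \<Rightarrow> 'a \<Rightarrow> ennreal" where
  "intrinsic_edist X x y =
     (INF g \<in> {g. path g \<and> path_image g \<subseteq> X \<and> pathstart g = x \<and> pathfinish g = y}.
        curve_length g)"

text \<open>The value is $0$ where \<open>intrinsic_edist\<close> is infinite. Such pairs are excluded as soon as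
  \<open>Metric_space X (intrinsic_dist X)\<close> is required; see the lemma below.\<close>

definition intrinsic_dist :: "'a::metric_space set \<Rightarrow> 'a \<Rightarrow> 'a \<Rightarrow> real" where
  "intrinsic_dist X x y = enn2real (intrinsic_edist X x y)"

definition intrinsic_metric :: "'a::metric_space set \<Rightarrow> 'a metric" where
  "intrinsic_metric X = metric (X, intrinsic_dist X)"

lemma intrinsic_edist_finite:
  assumes "Metric_space X (intrinsic_dist X)" "x \<in> X" "y \<in> X"
  shows "intrinsic_edist X x y < \<infinity>"
proof (cases "x = y")
  case True
  have "intrinsic_edist X x x \<le> curve_length (\<lambda>_. x)"
    unfolding intrinsic_edist_def
    by (rule INF_lower) (use assms(2) in \<open>auto simp: path_def path_image_def pathstart_def pathfinish_def\<close>)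
  also have "curve_length (\<lambda>_. x) \<le> 0"
    unfolding curve_length_def by (rule SUP_least) simp
  finally show ?thesis using True by (simp add: order_le_less_trans)
next
  case False
  then have "intrinsic_dist X x y \<noteq> 0"
    using Metric_space.zero[OF assms] by simp
  then show ?thesis
    by (auto simp: intrinsic_dist_def enn2real_eq_0_iff less_top)
qed

definition complete_geodesic_space :: "'a set \<Rightarrow> ('a \<Rightarrow> 'a \<Rightarrow> real) \<Rightarrow> bool" where
  "complete_geodesic_space M d \<longleftrightarrow>
     Metric_space M d \<and> Metric_space.mcomplete M d \<and>
     (\<forall>x\<in>M. \<forall>y\<in>M. \<exists>g. g ` {0..d x y} \<subseteq> M \<and> g 0 = x \<and> g (d x y) = y \<and>
        (\<forall>s\<in>{0..d x y}. \<forall>t\<in>{0..d x y}. d (g s) (g t) = \<bar>s - t\<bar>))"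

subsection \<open>Semicontinuity and envelopes\<close>

definition usc_map :: "'a topology \<Rightarrow> ('a \<Rightarrow> real) \<Rightarrow> bool" where
  "usc_map T f \<longleftrightarrow> (\<forall>c. openin T {x \<in> topspace T. f x < c})"

definition lsc_map :: "'a topology \<Rightarrow> ('a \<Rightarrow> real) \<Rightarrow> bool" where
  "lsc_map T f \<longleftrightarrow> (\<forall>c. openin T {x \<in> topspace T. c < f x})"

text \<open>The neighbourhood filter \<open>nhdsin\<close> includes the point itself, so these are
  $\lim_{r\to 0}\sup_{B(x,r)} f$ and $\lim_{r\to 0}\inf_{B(x,r)} f$.\<close>

definition usc_env :: "'a metric \<Rightarrow> ('a \<Rightarrow> real) \<Rightarrow> 'a \<Rightarrow> ereal" where
  "usc_env m f x = Limsup (nhdsin (mtopology_of m) x) (\<lambda>y. ereal (f y))"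

definition lsc_env :: "'a metric \<Rightarrow> ('a \<Rightarrow> real) \<Rightarrow> 'a \<Rightarrow> ereal" where
  "lsc_env m f x = Liminf (nhdsin (mtopology_of m) x) (\<lambda>y. ereal (f y))"

subsection \<open>Slopes and test functions\<close>

text \<open>At an isolated point the punctured neighbourhood filter is trivial. Slopes are only used for
  locally Lipschitz functions, for which the upper limit below is finite.\<close>

definition punctured_limsup :: "'a metric \<Rightarrow> 'a \<Rightarrow> ('a \<Rightarrow> real) \<Rightarrow> real" where
  "punctured_limsup m x q =
     (if atin (mtopology_of m) x = bot then 0
      else real_of_ereal (Limsup (atin (mtopology_of m) x) (\<lambda>y. ereal (q y))))"

definition slope :: "'a metric \<Rightarrow> ('a \<Rightarrow> real) \<Rightarrow> 'a \<Rightarrow> real" where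
  "slope m u x = punctured_limsup m x (\<lambda>y. \<bar>u y - u x\<bar> / mdist m x y)"

definition slope_plus :: "'a metric \<Rightarrow> ('a \<Rightarrow> real) \<Rightarrow> 'a \<Rightarrow> real" where
  "slope_plus m u x = punctured_limsup m x (\<lambda>y. max (u y - u x) 0 / mdist m x y)"

definition slope_minus :: "'a metric \<Rightarrow> ('a \<Rightarrow> real) \<Rightarrow> 'a \<Rightarrow> real" where
  "slope_minus m u x = punctured_limsup m x (\<lambda>y. max (- (u y - u x)) 0 / mdist m x y)"

definition locally_Lipschitz :: "'a metric \<Rightarrow> ('a \<Rightarrow> real) \<Rightarrow> bool" where
  "locally_Lipschitz m u \<longleftrightarrow>
     (\<forall>x\<in>mspace m. \<exists>r>0.
        Lipschitz_continuous_map (submetric m (mball_of m x r)) euclidean_metric u)"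

definition C1_plus :: "'a metric \<Rightarrow> ('a \<Rightarrow> real) \<Rightarrow> bool" where
  "C1_plus m u \<longleftrightarrow>
     locally_Lipschitz m u \<and>
     continuous_map (mtopology_of m) euclideanreal (slope m u) \<and>
     (\<forall>x\<in>mspace m. slope_plus m u x = slope m u x)"

definition C1_minus :: "'a metric \<Rightarrow> ('a \<Rightarrow> real) \<Rightarrow> bool" where
  "C1_minus m u \<longleftrightarrow>
     locally_Lipschitz m u \<and>
     continuous_map (mtopology_of m) euclideanreal (slope m u) \<and>
     (\<forall>x\<in>mspace m. slope_minus m u x = slope m u x)"

subsection \<open>Metric viscosity solutions\<close>

text \<open>Hamiltonians \<open>H x u p\<close> are total functions, but only their values at $x$ in the space and
  $p \ge 0$ enter. The modified Hamiltonians may be infinite since $H$ need not be locally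
  bounded.\<close>

definition Ham_inf ::
  "('a \<Rightarrow> real \<Rightarrow> real \<Rightarrow> real) \<Rightarrow> real \<Rightarrow> 'a \<Rightarrow> real \<Rightarrow> real \<Rightarrow> ereal" where
  "Ham_inf H a x u p = (INF p'\<in>{p'. 0 \<le> p' \<and> \<bar>p' - p\<bar> \<le> a}. ereal (H x u p'))"

definition Ham_sup ::
  "('a \<Rightarrow> real \<Rightarrow> real \<Rightarrow> real) \<Rightarrow> real \<Rightarrow> 'a \<Rightarrow> real \<Rightarrow> real \<Rightarrow> ereal" where
  "Ham_sup H a x u p = (SUP p'\<in>{p'. 0 \<le> p' \<and> \<bar>p' - p\<bar> \<le> a}. ereal (H x u p'))"

definition viscosity_subsolution ::
  "'a metric \<Rightarrow> ('a \<Rightarrow> real \<Rightarrow> real \<Rightarrow> real) \<Rightarrow> ('a \<Rightarrow> real) \<Rightarrow> bool" where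
  "viscosity_subsolution m H u \<longleftrightarrow>
     (\<forall>x\<in>mspace m. \<bar>usc_env m u x\<bar> \<noteq> \<infinity>) \<and>
     (\<forall>\<psi>1 \<psi>2. \<forall>x\<in>mspace m.
        C1_minus m \<psi>1 \<longrightarrow> locally_Lipschitz m \<psi>2 \<longrightarrow>
        (\<forall>\<^sub>F y in nhdsin (mtopology_of m) x.
           real_of_ereal (usc_env m u y) - (\<psi>1 y + \<psi>2 y)
             \<le> real_of_ereal (usc_env m u x) - (\<psi>1 x + \<psi>2 x)) \<longrightarrow>
        Ham_inf H (real_of_ereal (usc_env m (slope m \<psi>2) x)) x
          (real_of_ereal (usc_env m u x)) (slope m \<psi>1 x) \<le> 0)"

definition viscosity_supersolution ::
  "'a metric \<Rightarrow> ('a \<Rightarrow> real \<Rightarrow> real \<Rightarrow> real) \<Rightarrow> ('a \<Rightarrow> real) \<Rightarrow> bool" where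
  "viscosity_supersolution m H u \<longleftrightarrow>
     (\<forall>x\<in>mspace m. \<bar>lsc_env m u x\<bar> \<noteq> \<infinity>) \<and>
     (\<forall>\<psi>1 \<psi>2. \<forall>x\<in>mspace m.
        C1_plus m \<psi>1 \<longrightarrow> locally_Lipschitz m \<psi>2 \<longrightarrow>
        (\<forall>\<^sub>F y in nhdsin (mtopology_of m) x.
           real_of_ereal (lsc_env m u x) - (\<psi>1 x + \<psi>2 x)
             \<le> real_of_ereal (lsc_env m u y) - (\<psi>1 y + \<psi>2 y)) \<longrightarrow>
        Ham_sup H (real_of_ereal (usc_env m (slope m \<psi>2) x)) x
          (real_of_ereal (lsc_env m u x)) (slope m \<psi>1 x) \<ge> 0)"

subsection \<open>Semilimits along a sequence of spaces\<close>

text \<open>A family $(X_n)_{n\in\mathbb{N}\cup\{\infty\}}$ is indexed by \<open>enat\<close>; convergence in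
  \<open>approx_seqs\<close> is with respect to the ambient metric.\<close>

definition approx_seqs :: "(enat \<Rightarrow> 'a::metric_space set) \<Rightarrow> 'a \<Rightarrow> (nat \<Rightarrow> 'a) set" where
  "approx_seqs X x = {s. (\<forall>n. s n \<in> X (enat n)) \<and> s \<longlonglongrightarrow> x}"

definition upper_semilimit ::
  "(enat \<Rightarrow> 'a::metric_space set) \<Rightarrow> (nat \<Rightarrow> 'a \<Rightarrow> real) \<Rightarrow> 'a \<Rightarrow> ereal" where
  "upper_semilimit X u x = (SUP s\<in>approx_seqs X x. limsup (\<lambda>n. ereal (u n (s n))))"

definition lower_semilimit ::
  "(enat \<Rightarrow> 'a::metric_space set) \<Rightarrow> (nat \<Rightarrow> 'a \<Rightarrow> real) \<Rightarrow> 'a \<Rightarrow> ereal" where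
  "lower_semilimit X u x = (INF s\<in>approx_seqs X x. liminf (\<lambda>n. ereal (u n (s n))))"

end

(*
Part (b) is part (a) for -u and the Hamiltonian -H(x, -r, p). For part (a), the hypothesis on suprema
over balls is applied to functions phi_n with finite support; it yields a radius delta such that
sequences in the balls B(a_n, delta; X_n) accumulate in X_infinity. Let v be the upper semilimit and
let v - psi_1 - psi_2 have a local maximum at a. A general test function psi_1 on X_infinity does not
live on X_n. However, if p = |grad psi_1|(a) > 0, then since |grad^- psi_1| = |grad psi_1| there is
a point y close to a with psi_1(y) <= psi_1(a) - (p - eps) d(a,y), and psi_1(x) <= psi_1(y) +
(p + eps) d(x,y) near a. Hence the squared distance p d(x,y)^2 / (2 d(a,y)) can replace psi_1 up to an
error absorbed by a small multiple of d(x,a), and psi_2 is replaced by a multiple of d(x,a) as well.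
Such functions do transfer to X_n along y_n -> y and a_n -> a. The balls of X_n need not be compact, so
a maximum on X_n is produced by Ekeland's principle, whose Lipschitz perturbation is again
of type psi_2. The viscosity inequalities obtained on X_n pass to the limit by (3).
*)
theory Submission
  imports Defs
begin

subsection \<open>Envelopes and slopes in metric terms\<close>

text \<open>Two difficulties shape the quantities. The radius in the ball hypothesis may depend on
  the functions, so one family has to defeat all small radii at once; this is why the contradiction
  treats the radii 1/(k+1) simultaneously. The outcome stands in for compactness: a property that
  holds eventually along every sequence converging to a point of X_infinity holds eventually on a
  whole ball of X_n. The parabola works only on the right scale. Put t = d(a,y) and localise to the
  ball of radius s = \<theta> t about a. There the slope p d(x,y)/t of the parabola differs from p
  by at most p \<theta>, which fixes \<theta> in terms of \<epsilon> and p. Replacing psi_1 costs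
  \<epsilon>1 times a multiple of t, whereas the cone at a gains a multiple of \<epsilon> s on the
  sphere of radius s; hence \<epsilon>1 is of order \<epsilon> \<theta>. The choices are therefore
  made in the order \<epsilon>, \<theta>, \<epsilon>1, y, s. The comparison itself rests on
  convexity: the parabola lies above its tangent p X - p t/2 at X = t, and this linear function of
  the distance X = d(x,y) matches the growth bound of psi_1.\<close>

lemma openin_mtopology_of:
  "openin (mtopology_of m) U \<longleftrightarrow>
    U \<subseteq> mspace m \<and> (\<forall>x\<in>U. \<exists>r>0. \<forall>y\<in>mspace m. mdist m x y < r \<longrightarrow> y \<in> U)"
  unfolding mtopology_of_def Metric_space.openin_mtopology[OF Metric_space_mspace_mdist]
  by (intro conj_cong refl) (simp add: Ball_def subset_iff Metric_space.in_mball[OF Metric_space_mspace_mdist], blast)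

lemma mdist_self [simp]: "x \<in> mspace m \<Longrightarrow> mdist m x x = 0"
  by simp

lemma openin_mball_of: "openin (mtopology_of m) (mball_of m x r)"
  by (simp add: mtopology_of_def mball_of_def Metric_space.openin_mball)

lemma eventually_nhdsin_mdist:
  assumes "x \<in> mspace m"
  shows "eventually P (nhdsin (mtopology_of m) x) \<longleftrightarrow>
    (\<exists>r>0. \<forall>y\<in>mspace m. mdist m x y < r \<longrightarrow> P y)"
proof
  assume "eventually P (nhdsin (mtopology_of m) x)"
  then obtain S where "openin (mtopology_of m) S" "x \<in> S" "\<forall>y\<in>S. P y"
    using assms by (auto simp: eventually_nhdsin)
  then show "\<exists>r>0. \<forall>y\<in>mspace m. mdist m x y < r \<longrightarrow> P y"
    unfolding openin_mtopology_of by blast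
next
  assume "\<exists>r>0. \<forall>y\<in>mspace m. mdist m x y < r \<longrightarrow> P y"
  then obtain r where "r > 0" "\<forall>y\<in>mspace m. mdist m x y < r \<longrightarrow> P y" by blast
  then show "eventually P (nhdsin (mtopology_of m) x)"
    using assms openin_mball_of[of m x r] unfolding eventually_nhdsin
    by (intro disjI2 exI[of _ "mball_of m x r"]) simp
qed

lemma eventually_atin_mdist:
  assumes "x \<in> mspace m"
  shows "eventually P (atin (mtopology_of m) x) \<longleftrightarrow>
    (\<exists>r>0. \<forall>y\<in>mspace m. y \<noteq> x \<longrightarrow> mdist m x y < r \<longrightarrow> P y)"
proof -
  have "eventually P (atin (mtopology_of m) x) \<longleftrightarrow>
      eventually (\<lambda>y. y \<in> mspace m \<and> y \<noteq> x \<longrightarrow> P y) (nhdsin (mtopology_of m) x)"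
    unfolding atin_def by (simp add: eventually_inf_principal)
  also have "\<dots> \<longleftrightarrow> (\<exists>r>0. \<forall>y\<in>mspace m. y \<noteq> x \<longrightarrow> mdist m x y < r \<longrightarrow> P y)"
    unfolding eventually_nhdsin_mdist[OF assms] by (intro iff_exI conj_cong ball_cong refl) auto
  finally show ?thesis .
qed

lemma usc_map_iff:
  "usc_map (mtopology_of m) f \<longleftrightarrow>
    (\<forall>x\<in>mspace m. \<forall>c>f x. \<exists>r>0. \<forall>y\<in>mspace m. mdist m x y < r \<longrightarrow> f y < c)"
  unfolding usc_map_def openin_mtopology_of by auto

lemma usc_env_le:
  assumes "x \<in> mspace m" "\<And>y. y \<in> mspace m \<Longrightarrow> mdist m x y < r \<Longrightarrow> f y \<le> c" "r > 0"
  shows "usc_env m f x \<le> ereal c"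
  unfolding usc_env_def
  by (rule Limsup_bounded) (use assms in \<open>auto simp: eventually_nhdsin_mdist[OF assms(1)]\<close>)

lemma usc_env_lessD:
  assumes "x \<in> mspace m" "usc_env m f x < ereal c"
  obtains r where "r > 0" "\<And>y. y \<in> mspace m \<Longrightarrow> mdist m x y < r \<Longrightarrow> f y < c"
proof -
  have "eventually (\<lambda>y. ereal (f y) < ereal c) (nhdsin (mtopology_of m) x)"
    using Limsup_lessD assms(2) unfolding usc_env_def by blast
  then show thesis
    unfolding eventually_nhdsin_mdist[OF assms(1)] using that by auto
qed

lemma le_usc_env:
  assumes "x \<in> mspace m"
  shows "ereal (f x) \<le> usc_env m f x"
proof (rule ccontr)
  assume "\<not> ?thesis"
  then have "usc_env m f x < ereal (f x)" by simp
  then obtain r where "r > 0" "\<And>y. y \<in> mspace m \<Longrightarrow> mdist m x y < r \<Longrightarrow> f y < f x"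
    using usc_env_lessD[OF assms] by blast
  from this(2)[of x] this(1) assms show False by simp
qed

lemma less_usc_envD:
  assumes "x \<in> mspace m" "ereal c < usc_env m f x" "r > 0"
  obtains y where "y \<in> mspace m" "mdist m x y < r" "c < f y"
  using usc_env_le[OF assms(1) _ assms(3), of f c] assms(2) by (meson not_le)

lemma usc_env_eq_of_usc:
  assumes "usc_map (mtopology_of m) f" "x \<in> mspace m"
  shows "usc_env m f x = ereal (f x)"
proof (rule antisym)
  show "usc_env m f x \<le> ereal (f x)"
  proof (rule ereal_le_epsilon2)
    fix e :: real assume "0 < e"
    then obtain r where "r > 0" "\<And>y. y \<in> mspace m \<Longrightarrow> mdist m x y < r \<Longrightarrow> f y < f x + e"
      using assms unfolding usc_map_iff by (metis less_add_same_cancel1)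
    then show "usc_env m f x \<le> ereal (f x) + ereal e"
      using usc_env_le[of x m r f "f x + e"] assms(2) by force
  qed
qed (rule le_usc_env[OF assms(2)])

lemma usc_map_usc_env:
  assumes fin: "\<And>x. x \<in> mspace m \<Longrightarrow> \<bar>usc_env m f x\<bar> \<noteq> \<infinity>"
  shows "usc_map (mtopology_of m) (\<lambda>x. real_of_ereal (usc_env m f x))"
  unfolding usc_map_iff
proof (intro ballI allI impI)
  fix x c assume x: "x \<in> mspace m" and c: "real_of_ereal (usc_env m f x) < c"
  define c' where "c' = (real_of_ereal (usc_env m f x) + c) / 2"
  have c': "real_of_ereal (usc_env m f x) < c'" "c' < c" using c by (auto simp: c'_def)
  have "usc_env m f x < ereal c'" using fin[OF x] c' by (cases "usc_env m f x") auto
  then obtain r where r: "r > 0" "\<And>y. y \<in> mspace m \<Longrightarrow> mdist m x y < r \<Longrightarrow> f y < c'"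
    using usc_env_lessD[OF x] by blast
  have "real_of_ereal (usc_env m f y) < c" if y: "y \<in> mspace m" "mdist m x y < r" for y
  proof -
    have "usc_env m f y \<le> ereal c'"
    proof (rule usc_env_le[OF y(1)])
      show "r - mdist m x y > 0" using y by simp
      show "f z \<le> c'" if "z \<in> mspace m" "mdist m y z < r - mdist m x y" for z
        using r(2)[of z] mdist_triangle[of x m y z] that x y by simp
    qed
    then show ?thesis using fin[OF y(1)] c' by (cases "usc_env m f y") auto
  qed
  then show "\<exists>r>0. \<forall>y\<in>mspace m. mdist m x y < r \<longrightarrow> real_of_ereal (usc_env m f y) < c"
    using r(1) by blast
qed

section \<open>Locally Lipschitz functions and estimates from slopes\<close>

lemma locally_Lipschitz_iff:
  "locally_Lipschitz m u \<longleftrightarrow> (\<forall>x\<in>mspace m. \<exists>r>0. \<exists>B.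
     \<forall>y\<in>mspace m. \<forall>z\<in>mspace m. mdist m x y < r \<longrightarrow> mdist m x z < r \<longrightarrow>
       \<bar>u y - u z\<bar> \<le> B * mdist m y z)"
  unfolding locally_Lipschitz_def Lipschitz_continuous_map_def
  by (rule ball_cong[OF refl], rule iff_exI, rule conj_cong[OF refl])
    (simp, rule iff_exI, auto simp: dist_real_def)

lemma Lipschitz_imp_locally_Lipschitz:
  assumes "\<And>y z. y \<in> mspace m \<Longrightarrow> z \<in> mspace m \<Longrightarrow> \<bar>u y - u z\<bar> \<le> B * mdist m y z"
  shows "locally_Lipschitz m u"
  unfolding locally_Lipschitz_iff using assms zero_less_one by blast

text \<open>The hypothesis \<open>lo\<close> plays two parts: besides the lower bound it supplies
  points other than \<open>x\<close> in every ball, so that the default value at isolated points is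
  excluded.\<close>

lemma punctured_limsup_eqI:
  assumes x: "x \<in> mspace m"
    and up: "\<And>e. e > 0 \<Longrightarrow> \<exists>r>0. \<forall>y\<in>mspace m. y \<noteq> x \<longrightarrow> mdist m x y < r \<longrightarrow> q y \<le> v + e"
    and lo: "\<And>e r. e > 0 \<Longrightarrow> r > 0 \<Longrightarrow> \<exists>y\<in>mspace m. y \<noteq> x \<and> mdist m x y < r \<and> v - e \<le> q y"
  shows "punctured_limsup m x q = v"
proof -
  let ?F = "atin (mtopology_of m) x"
  have "?F \<noteq> bot"
  proof
    assume "?F = bot"
    then have "\<forall>\<^sub>F y in ?F. False" by simp
    then obtain r where "r > 0" "\<forall>y\<in>mspace m. y \<noteq> x \<longrightarrow> mdist m x y < r \<longrightarrow> False"
      unfolding eventually_atin_mdist[OF x] by blast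
    then show False using lo[OF zero_less_one, of r] by blast
  qed
  moreover have "Limsup ?F (\<lambda>y. ereal (q y)) = ereal v"
  proof (rule antisym)
    show "Limsup ?F (\<lambda>y. ereal (q y)) \<le> ereal v"
    proof (rule ereal_le_epsilon2)
      fix e :: real assume "0 < e"
      have "\<forall>\<^sub>F y in ?F. ereal (q y) \<le> ereal v + ereal e"
        unfolding eventually_atin_mdist[OF x] using up[OF \<open>0 < e\<close>] by simp
      then show "Limsup ?F (\<lambda>y. ereal (q y)) \<le> ereal v + ereal e"
        by (rule Limsup_bounded)
    qed
    show "ereal v \<le> Limsup ?F (\<lambda>y. ereal (q y))"
    proof (rule ccontr)
      assume "\<not> ?thesis"
      then obtain c where c: "Limsup ?F (\<lambda>y. ereal (q y)) < ereal c" "ereal c < ereal v"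
        by (meson ereal_dense2 not_le)
      then have "eventually (\<lambda>y. ereal (q y) < ereal c) ?F" by (blast dest: Limsup_lessD)
      then obtain r where "r > 0" "\<And>y. y \<in> mspace m \<Longrightarrow> y \<noteq> x \<Longrightarrow> mdist m x y < r \<Longrightarrow> q y < c"
        unfolding eventually_atin_mdist[OF x] by fastforce
      moreover obtain y where "y \<in> mspace m" "y \<noteq> x" "mdist m x y < r" "v - (v - c) \<le> q y"
        using lo[of "v - c" r] c(2) \<open>r > 0\<close> by auto
      ultimately have "q y < c" "c \<le> q y" by auto
      then show False by simp
    qed
  qed
  ultimately show ?thesis by (simp add: punctured_limsup_def)
qed

text \<open>The two-sided bound on \<open>q\<close> keeps the upper limit finite, so that
  \<open>real_of_ereal\<close> does not turn an infinite value into 0. At an isolated point the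
  conclusion is vacuous for a small radius.\<close>

lemma punctured_limsup_lessD:
  assumes x: "x \<in> mspace m" and less: "punctured_limsup m x q < c" and r0: "r0 > 0"
    and bd: "\<And>y. y \<in> mspace m \<Longrightarrow> y \<noteq> x \<Longrightarrow> mdist m x y < r0 \<Longrightarrow> 0 \<le> q y \<and> q y \<le> B"
  obtains r where "r > 0" "\<And>y. y \<in> mspace m \<Longrightarrow> y \<noteq> x \<Longrightarrow> mdist m x y < r \<Longrightarrow> q y < c"
proof (cases "atin (mtopology_of m) x = bot")
  case True
  then have "eventually (\<lambda>y. False) (atin (mtopology_of m) x)" by simp
  then show thesis unfolding eventually_atin_mdist[OF x] using that by blast
next
  case False
  let ?L = "Limsup (atin (mtopology_of m) x) (\<lambda>y. ereal (q y))"
  have ev: "\<forall>\<^sub>F y in atin (mtopology_of m) x. 0 \<le> q y \<and> q y \<le> B"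
    unfolding eventually_atin_mdist[OF x] using bd r0 by blast
  have "?L \<le> ereal B"
    by (rule Limsup_bounded) (rule eventually_mono[OF ev], simp)
  moreover have "0 \<le> ?L"
    by (rule le_Limsup[OF False]) (rule eventually_mono[OF ev], simp)
  ultimately have "?L < ereal c"
    using less False by (cases ?L) (auto simp: punctured_limsup_def)
  then have "eventually (\<lambda>y. ereal (q y) < ereal c) (atin (mtopology_of m) x)"
    by (rule Limsup_lessD)
  then obtain r where r: "r > 0"
      "\<forall>y\<in>mspace m. y \<noteq> x \<longrightarrow> mdist m x y < r \<longrightarrow> ereal (q y) < ereal c"
    unfolding eventually_atin_mdist[OF x] by blast
  show thesis by (rule that[OF r(1)]) (use r(2) in simp)
qed

text \<open>With \<open>c \<ge> 0\<close> neither source of a default value 0 can exceed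
  \<open>c\<close>: not the isolated point, and not an upper limit equal to minus infinity.\<close>

lemma less_punctured_limsupD:
  assumes x: "x \<in> mspace m" and less: "c < punctured_limsup m x q" and c: "c \<ge> 0" and r: "r > 0"
  obtains y where "y \<in> mspace m" "y \<noteq> x" "mdist m x y < r" "c < q y"
proof -
  have "\<exists>y\<in>mspace m. y \<noteq> x \<and> mdist m x y < r \<and> c < q y"
  proof (rule ccontr)
    assume no: "\<not> ?thesis"
    let ?L = "Limsup (atin (mtopology_of m) x) (\<lambda>y. ereal (q y))"
    have "\<forall>y\<in>mspace m. y \<noteq> x \<longrightarrow> mdist m x y < r \<longrightarrow> ereal (q y) \<le> ereal c"
      using no by (meson ereal_less_eq(3) not_le)
    then have "\<forall>\<^sub>F y in atin (mtopology_of m) x. ereal (q y) \<le> ereal c"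
      unfolding eventually_atin_mdist[OF x] using r by blast
    then have "?L \<le> ereal c" by (rule Limsup_bounded)
    then have "real_of_ereal ?L \<le> c" using c by (cases ?L) auto
    then show False using less c by (auto simp: punctured_limsup_def split: if_splits)
  qed
  then show thesis using that by blast
qed

text \<open>One end of the difference is always \<open>x\<close>: the slope at a single point
  controls no difference between two other points. The two-point estimate needs a slope bound on a
  whole ball and is \<open>Lipschitz_of_slope_less\<close>.\<close>

lemma slope_lessD:
  assumes "locally_Lipschitz m u" and x: "x \<in> mspace m" and less: "slope m u x < L"
  obtains r where "r > 0"
    "\<And>y. y \<in> mspace m \<Longrightarrow> mdist m x y < r \<Longrightarrow> \<bar>u y - u x\<bar> \<le> L * mdist m x y"
proof -
  obtain r0 B where r0: "r0 > 0" and B: "\<And>y z. y \<in> mspace m \<Longrightarrow> z \<in> mspace m \<Longrightarrow>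
      mdist m x y < r0 \<Longrightarrow> mdist m x z < r0 \<Longrightarrow> \<bar>u y - u z\<bar> \<le> B * mdist m y z"
    using assms(1) x unfolding locally_Lipschitz_iff by meson
  have pos: "mdist m x y > 0" if "y \<in> mspace m" "y \<noteq> x" for y
    using that x by (metis less_eq_real_def mdist_nonneg mdist_zero)
  have "0 \<le> \<bar>u y - u x\<bar> / mdist m x y \<and> \<bar>u y - u x\<bar> / mdist m x y \<le> B"
    if "y \<in> mspace m" "y \<noteq> x" "mdist m x y < r0" for y
    using B[of y x] pos[of y] that x r0 by (simp add: divide_le_eq mdist_commute)
  then obtain r where r: "r > 0"
    "\<And>y. y \<in> mspace m \<Longrightarrow> y \<noteq> x \<Longrightarrow> mdist m x y < r \<Longrightarrow> \<bar>u y - u x\<bar> / mdist m x y < L"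
    using punctured_limsup_lessD[OF x less[unfolded slope_def] r0, of B] by blast
  show thesis
  proof (rule that[OF r(1)])
    fix y assume y: "y \<in> mspace m" "mdist m x y < r"
    show "\<bar>u y - u x\<bar> \<le> L * mdist m x y"
    proof (cases "y = x")
      case False
      then show ?thesis using r(2)[OF y(1) False y(2)] pos[OF y(1) False]
        by (simp add: divide_less_eq)
    qed (use x in simp)
  qed
qed

lemma less_slope_minusD:
  assumes x: "x \<in> mspace m" and less: "q < slope_minus m u x" and q: "q \<ge> 0" and r: "r > 0"
  obtains y where "y \<in> mspace m" "y \<noteq> x" "mdist m x y < r" "u y < u x - q * mdist m x y"
proof -
  obtain y where y: "y \<in> mspace m" "y \<noteq> x" "mdist m x y < r"
      "q < max (- (u y - u x)) 0 / mdist m x y"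
    using less_punctured_limsupD[OF x less[unfolded slope_minus_def] q r] by blast
  have "mdist m x y > 0" using y x by (metis less_eq_real_def mdist_nonneg mdist_zero)
  then have "q * mdist m x y < max (- (u y - u x)) 0" "0 \<le> q * mdist m x y"
    using y(4) q by (auto simp: less_divide_eq)
  then have "u y < u x - q * mdist m x y" by linarith
  with y that show thesis by blast
qed

lemma slope_bounds:
  assumes Lip: "\<And>y z. y \<in> mspace m \<Longrightarrow> z \<in> mspace m \<Longrightarrow> mdist m x0 y < r \<Longrightarrow> mdist m x0 z < r \<Longrightarrow>
      \<bar>u y - u z\<bar> \<le> B * mdist m y z"
    and x0: "x0 \<in> mspace m" and x: "x \<in> mspace m" "mdist m x0 x < r" and B: "B \<ge> 0"
  shows "0 \<le> slope m u x" "slope m u x \<le> B"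
proof -
  have q: "\<bar>u y - u x\<bar> / mdist m x y \<le> B" if "y \<in> mspace m" "mdist m x0 y < r" for y
    using Lip[of y x] that x B
    by (cases "mdist m x y = 0") (auto simp: divide_le_eq mdist_commute less_le)
  have "mdist m x0 y < r" if "y \<in> mspace m" "mdist m x y < r - mdist m x0 x" for y
    using mdist_triangle[OF x0 x(1) that(1)] that(2) by simp
  then have ev: "\<forall>\<^sub>F y in atin (mtopology_of m) x. \<bar>u y - u x\<bar> / mdist m x y \<le> B"
    unfolding eventually_atin_mdist[OF x(1)] using q x(2)
    by (intro exI[of _ "r - mdist m x0 x"]) simp
  let ?L = "Limsup (atin (mtopology_of m) x) (\<lambda>y. ereal (\<bar>u y - u x\<bar> / mdist m x y))"
  have le: "?L \<le> ereal B"
    by (rule Limsup_bounded) (rule eventually_mono[OF ev], simp)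
  have ge: "0 \<le> ?L" if "atin (mtopology_of m) x \<noteq> bot"
    by (rule le_Limsup[OF that]) simp
  have "0 \<le> slope m u x \<and> slope m u x \<le> B"
    using le ge B by (cases ?L) (auto simp: slope_def punctured_limsup_def)
  then show "0 \<le> slope m u x" "slope m u x \<le> B" by auto
qed

text \<open>A Lipschitz constant near \<open>x\<close> bounds all slopes near \<open>x\<close>,
  hence also their envelope. This turns the Lipschitz constant of a perturbation into the radius of
  the interval of momenta in \<open>Ham_inf\<close>.\<close>

lemma usc_env_slope_bounds:
  assumes Lip: "\<And>y z. y \<in> mspace m \<Longrightarrow> z \<in> mspace m \<Longrightarrow> mdist m x y < r \<Longrightarrow> mdist m x z < r \<Longrightarrow>
      \<bar>u y - u z\<bar> \<le> B * mdist m y z"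
    and x: "x \<in> mspace m" and r: "r > 0" and B: "B \<ge> 0"
  shows "0 \<le> usc_env m (slope m u) x" "usc_env m (slope m u) x \<le> ereal B"
proof -
  have "0 \<le> slope m u x" using slope_bounds(1)[OF Lip x x _ B] r x by simp
  then show "0 \<le> usc_env m (slope m u) x"
    using le_usc_env[OF x, of "slope m u"] by (meson ereal_less_eq(5) order_trans)
  show "usc_env m (slope m u) x \<le> ereal B"
    using slope_bounds(2)[OF Lip x _ _ B] by (intro usc_env_le[OF x _ r]) blast
qed

lemma usc_env_slope_finite:
  assumes "locally_Lipschitz m u" and x: "x \<in> mspace m"
  shows "\<bar>usc_env m (slope m u) x\<bar> \<noteq> \<infinity>" "0 \<le> usc_env m (slope m u) x"
proof -
  obtain r B where r: "r > 0" and B: "\<And>y z. y \<in> mspace m \<Longrightarrow> z \<in> mspace m \<Longrightarrow>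
      mdist m x y < r \<Longrightarrow> mdist m x z < r \<Longrightarrow> \<bar>u y - u z\<bar> \<le> B * mdist m y z"
    using assms unfolding locally_Lipschitz_iff by meson
  \<comment> \<open>The constant of \<open>locally_Lipschitz_iff\<close> carries no sign condition,
    so it is replaced by its absolute value.\<close>
  have "\<bar>u y - u z\<bar> \<le> \<bar>B\<bar> * mdist m y z"
    if "y \<in> mspace m" "z \<in> mspace m" "mdist m x y < r" "mdist m x z < r" for y z
    using B[OF that] mult_right_mono[OF abs_ge_self mdist_nonneg, of B m y z] by linarith
  from usc_env_slope_bounds[OF this x r abs_ge_zero]
  show "\<bar>usc_env m (slope m u) x\<bar> \<noteq> \<infinity>" "0 \<le> usc_env m (slope m u) x"
    by (cases "usc_env m (slope m u) x"; simp)+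
qed

lemma usc_map_diff:
  assumes "usc_map (mtopology_of m) f" "locally_Lipschitz m g"
  shows "usc_map (mtopology_of m) (\<lambda>x. f x - g x)"
  unfolding usc_map_iff
proof (intro ballI allI impI)
  fix x c assume x: "x \<in> mspace m" and c: "f x - g x < c"
  define e where "e = (c - (f x - g x)) / 2"
  have e: "e > 0" "f x + e + e - g x = c" using c by (auto simp: e_def)
  obtain r B where r: "r > 0" and B: "\<And>y z. y \<in> mspace m \<Longrightarrow> z \<in> mspace m \<Longrightarrow>
      mdist m x y < r \<Longrightarrow> mdist m x z < r \<Longrightarrow> \<bar>g y - g z\<bar> \<le> B * mdist m y z"
    using assms(2) x unfolding locally_Lipschitz_iff by meson
  obtain r' where r': "r' > 0" "\<And>y. y \<in> mspace m \<Longrightarrow> mdist m x y < r' \<Longrightarrow> f y < f x + e"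
    using assms(1) x e(1) unfolding usc_map_iff by (metis less_add_same_cancel1)
  have "f y - g y < c" if y: "y \<in> mspace m" "mdist m x y < min (min r r') (e / (\<bar>B\<bar> + 1))" for y
  proof -
    have "\<bar>g x - g y\<bar> \<le> B * mdist m x y" using B[OF x y(1)] y x r by simp
    also have "\<dots> \<le> (\<bar>B\<bar> + 1) * mdist m x y" by (intro mult_right_mono) auto
    also have "\<dots> < e" using y(2) by (simp add: less_divide_eq mult.commute)
    finally show ?thesis using r'(2)[OF y(1)] y(2) e(2) by auto
  qed
  moreover have "min (min r r') (e / (\<bar>B\<bar> + 1)) > 0" using r r'(1) e(1) by simp
  ultimately show "\<exists>r>0. \<forall>y\<in>mspace m. mdist m x y < r \<longrightarrow> f y - g y < c" by blast
qed

subsection \<open>Geodesic spaces and variational tools\<close>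

text \<open>A slope bound integrates along a geodesic. Two points within \<open>r / 3\<close> of the
  centre are less than \<open>2 * r / 3\<close> apart, so the geodesic between them stays in the
  ball of radius \<open>r\<close> on which the slope is controlled.\<close>

lemma Lipschitz_of_slope_less:
  assumes geo: "complete_geodesic_space (mspace m) (mdist m)" and Lip: "locally_Lipschitz m u"
    and x0: "x0 \<in> mspace m" and sl: "\<And>z. z \<in> mspace m \<Longrightarrow> mdist m x0 z < r \<Longrightarrow> slope m u z < L"
    and x: "x \<in> mspace m" "mdist m x0 x < r / 3" and y: "y \<in> mspace m" "mdist m x0 y < r / 3"
  shows "\<bar>u y - u x\<bar> \<le> L * mdist m x y"
proof -
  let ?D = "mdist m x y"
  obtain g where g: "g ` {0..?D} \<subseteq> mspace m" "g 0 = x" "g ?D = y"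
    "\<And>s t. s \<in> {0..?D} \<Longrightarrow> t \<in> {0..?D} \<Longrightarrow> mdist m (g s) (g t) = \<bar>s - t\<bar>"
    using geo x y unfolding complete_geodesic_space_def by meson
  have gM: "g t \<in> mspace m" if "0 \<le> t" "t \<le> ?D" for t using g(1) that by auto
  have D: "?D < 2 * r / 3"
    using mdist_triangle[of x m x0 y] x y x0 by (simp add: mdist_commute)
  have gr: "mdist m x0 (g t) < r" if "0 \<le> t" "t \<le> ?D" for t
  proof -
    have "mdist m x (g t) = t" using g(4)[of 0 t] g(2) that by simp
    then show ?thesis
      using mdist_triangle[of x0 m x "g t"] gM[OF that] x x0 D that by simp
  qed
  have "0 \<le> ?D" by simp
  \<comment> \<open>The estimate on a parameter interval is additive under concatenation, so by
    bisection it suffices to have it on all short intervals around each parameter. Such intervals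
    contain \<open>t\<close>, which matches the one-point form of
    \<open>slope_lessD\<close>.\<close>
  then have "(0::real) \<le> 0 \<and> ?D \<le> ?D \<longrightarrow> \<bar>u (g ?D) - u (g 0)\<bar> \<le> L * (?D - 0)"
  proof (rule Bolzano[of 0 ?D "\<lambda>a b. 0 \<le> a \<and> b \<le> ?D \<longrightarrow> \<bar>u (g b) - u (g a)\<bar> \<le> L * (b - a)"])
    fix a b c
    assume trans: "0 \<le> a \<and> b \<le> ?D \<longrightarrow> \<bar>u (g b) - u (g a)\<bar> \<le> L * (b - a)"
      "0 \<le> b \<and> c \<le> ?D \<longrightarrow> \<bar>u (g c) - u (g b)\<bar> \<le> L * (c - b)" "a \<le> b" "b \<le> c"
    show "0 \<le> a \<and> c \<le> ?D \<longrightarrow> \<bar>u (g c) - u (g a)\<bar> \<le> L * (c - a)"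
    proof
      assume "0 \<le> a \<and> c \<le> ?D"
      then have "\<bar>u (g b) - u (g a)\<bar> \<le> L * (b - a)" "\<bar>u (g c) - u (g b)\<bar> \<le> L * (c - b)"
        using trans by auto
      then show "\<bar>u (g c) - u (g a)\<bar> \<le> L * (c - a)" by (simp add: right_diff_distrib)
    qed
  next
    fix t assume local: "0 \<le> t" "t \<le> ?D"
    obtain d where d: "d > 0"
      "\<And>z. z \<in> mspace m \<Longrightarrow> mdist m (g t) z < d \<Longrightarrow> \<bar>u z - u (g t)\<bar> \<le> L * mdist m (g t) z"
      using slope_lessD[OF Lip gM sl[OF gM gr]] local by (metis atLeastAtMost_iff)
    have "\<bar>u (g b) - u (g a)\<bar> \<le> L * (b - a)"
      if ab: "a \<le> t" "t \<le> b" "b - a < d" "0 \<le> a" "b \<le> ?D" for a b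
    proof -
      have "mdist m (g t) (g a) = t - a" "mdist m (g t) (g b) = b - t"
        using g(4)[of t a] g(4)[of t b] ab by auto
      then have "\<bar>u (g a) - u (g t)\<bar> \<le> L * (t - a)" "\<bar>u (g b) - u (g t)\<bar> \<le> L * (b - t)"
        using d(2)[of "g a"] d(2)[of "g b"] gM[of a] gM[of b] ab by auto
      then show ?thesis by (simp add: right_diff_distrib)
    qed
    with d(1) show "\<exists>d>0. \<forall>a b. a \<le> t \<and> t \<le> b \<and> b - a < d \<longrightarrow>
        0 \<le> a \<and> b \<le> ?D \<longrightarrow> \<bar>u (g b) - u (g a)\<bar> \<le> L * (b - a)" by blast
  qed
  then show ?thesis using g by simp
qed

lemma abs_power2_diff_le:
  fixes a b d c :: real
  assumes "0 \<le> a" "0 \<le> b" "\<bar>a - b\<bar> \<le> d" "0 \<le> c"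
  shows "\<bar>c * a\<^sup>2 - c * b\<^sup>2\<bar> \<le> c * (d * (a + b))"
proof -
  have "\<bar>c * a\<^sup>2 - c * b\<^sup>2\<bar> = c * (\<bar>a - b\<bar> * (a + b))"
    using assms by (simp add: power2_eq_square square_diff_square_factored abs_mult
        flip: right_diff_distrib)
  also have "\<dots> \<le> c * (d * (a + b))"
    using assms by (intro mult_left_mono mult_right_mono) auto
  finally show ?thesis .
qed

lemma abs_mdist_diff_le:
  assumes "x \<in> mspace m" "y \<in> mspace m" "z \<in> mspace m"
  shows "\<bar>mdist m x z - mdist m y z\<bar> \<le> mdist m x y"
  using mdist_triangle[of x m y z] mdist_triangle[of y m x z] assms by (simp add: mdist_commute)

text \<open>The triangle inequality bounds the difference quotient by c(2D + d(x,z)), where D =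
  d(x,y). Moving from x towards y along a geodesic decreases the distance to y at unit speed and
  gives the descent quotient c(2D - t). Both tend to 2cD, so the descending slope equals the full
  slope.\<close>

lemma slope_sqdist:
  assumes geo: "complete_geodesic_space (mspace m) (mdist m)"
    and x: "x \<in> mspace m" and y: "y \<in> mspace m" and c: "c \<ge> 0"
  defines "f \<equiv> \<lambda>z. c * (mdist m z y)\<^sup>2"
  shows "slope m f x = 2 * c * mdist m x y" "slope_minus m f x = 2 * c * mdist m x y"
proof -
  let ?D = "mdist m x y"
  have pos: "mdist m x z > 0" if "z \<in> mspace m" "z \<noteq> x" for z
    using that x by (metis less_eq_real_def mdist_nonneg mdist_zero)
  have le: "max (- (f z - f x)) 0 / mdist m x z \<le> \<bar>f z - f x\<bar> / mdist m x z" for z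
    by (rule divide_right_mono) auto
  have "slope m f x = 2 * c * ?D \<and> slope_minus m f x = 2 * c * ?D"
  proof (cases "atin (mtopology_of m) x = bot")
    \<comment> \<open>A geodesic from \<open>x\<close> to a different point \<open>y\<close> would
      contain points arbitrarily close to \<open>x\<close>. Hence an isolated \<open>x\<close>
      equals \<open>y\<close>, and the default slope 0 agrees with the formula.\<close>
    case True
    have "x = y"
    proof (rule ccontr)
      assume ne: "x \<noteq> y"
      have "\<forall>\<^sub>F z in atin (mtopology_of m) x. False" using True by simp
      then obtain r where r: "r > 0" "\<forall>z\<in>mspace m. z \<noteq> x \<longrightarrow> mdist m x z < r \<longrightarrow> False"
        unfolding eventually_atin_mdist[OF x] by blast
      obtain g where g: "g ` {0..?D} \<subseteq> mspace m" "g 0 = x"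
        "\<And>s t. s \<in> {0..?D} \<Longrightarrow> t \<in> {0..?D} \<Longrightarrow> mdist m (g s) (g t) = \<bar>s - t\<bar>"
        using geo x y unfolding complete_geodesic_space_def by meson
      define t where "t = min ?D (r / 2)"
      have t: "0 < t" "t \<le> ?D" "t < r" using r pos[of y] ne y by (auto simp: t_def)
      have "g t \<in> mspace m" using g(1) t by auto
      moreover have "mdist m x (g t) = t" using g(3)[of 0 t] g(2) t by simp
      ultimately show False using r(2) t x by force
    qed
    then show ?thesis using True x by (simp add: slope_def slope_minus_def punctured_limsup_def)
  next
    case False
    have up: "\<exists>r>0. \<forall>z\<in>mspace m. z \<noteq> x \<longrightarrow> mdist m x z < r \<longrightarrow>
        \<bar>f z - f x\<bar> / mdist m x z \<le> 2 * c * ?D + e" if e: "e > 0" for e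
    proof (intro exI conjI ballI impI)
      show "e / (c + 1) > 0" using e c by simp
      fix z assume z: "z \<in> mspace m" "z \<noteq> x" "mdist m x z < e / (c + 1)"
      let ?d = "mdist m x z"
      have "\<bar>f z - f x\<bar> \<le> c * (?d * (mdist m z y + ?D))"
        unfolding f_def using abs_mdist_diff_le[OF z(1) x y] c
        by (intro abs_power2_diff_le) (auto simp: mdist_commute)
      also have "\<dots> \<le> c * (?d * (2 * ?D + ?d))"
        using abs_mdist_diff_le[OF z(1) x y] c
        by (intro mult_left_mono) (auto simp: mdist_commute)
      finally have "\<bar>f z - f x\<bar> / ?d \<le> c * (2 * ?D + ?d)"
        using pos[OF z(1,2)] by (simp add: divide_le_eq mult_ac)
      also have "c * ?d \<le> e"
      proof -
        have "c * ?d \<le> (c + 1) * ?d" by (simp add: distrib_right)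
        also have "\<dots> \<le> e" using z(3) c by (simp add: less_divide_eq mult.commute)
        finally show ?thesis .
      qed
      then have "c * (2 * ?D + ?d) \<le> 2 * c * ?D + e" by (simp add: distrib_left)
      finally show "\<bar>f z - f x\<bar> / ?d \<le> 2 * c * ?D + e" .
    qed
    have lo: "\<exists>z\<in>mspace m. z \<noteq> x \<and> mdist m x z < r \<and>
        2 * c * ?D - e \<le> max (- (f z - f x)) 0 / mdist m x z" if e: "e > 0" and r: "r > 0" for e r
    proof (cases "x = y")
      case True
      obtain z where z: "z \<in> mspace m" "z \<noteq> x" "mdist m x z < r"
        using False r unfolding trivial_limit_def eventually_atin_mdist[OF x] by blast
      moreover have "0 \<le> max (- (f z - f x)) 0 / mdist m x z" by simp
      moreover have "2 * c * ?D - e \<le> 0" using True x e by simp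
      ultimately show ?thesis by (meson order_trans)
    next
      case ne: False
      obtain g where g: "g ` {0..?D} \<subseteq> mspace m" "g 0 = x" "g ?D = y"
        "\<And>s t. s \<in> {0..?D} \<Longrightarrow> t \<in> {0..?D} \<Longrightarrow> mdist m (g s) (g t) = \<bar>s - t\<bar>"
        using geo x y unfolding complete_geodesic_space_def by meson
      \<comment> \<open>The last bound makes \<open>c * t \<le> e\<close>; the denominator is
        \<open>c + 1\<close> because \<open>c\<close> may vanish.\<close>
      define t where "t = min ?D (min (r / 2) (e / (c + 1)))"
      have t: "0 < t" "t \<le> ?D" "t < r" "t \<le> e / (c + 1)"
        using r e c pos[of y] ne y by (auto simp: t_def)
      have gt: "g t \<in> mspace m" using g(1) t by auto
      have d: "mdist m x (g t) = t" "mdist m (g t) y = ?D - t"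
        using g(4)[of 0 t] g(4)[of t ?D] g(2,3) t by auto
      have "c * t \<le> (c + 1) * t" using t by (simp add: distrib_right)
      also have "\<dots> \<le> e" using t(4) c by (simp add: le_divide_eq mult.commute)
      finally have "2 * c * ?D - e \<le> c * (2 * ?D - t)" by (simp add: right_diff_distrib)
      also have "\<dots> = - (f (g t) - f x) / t"
        using t(1) by (simp add: f_def d power2_eq_square field_simps)
      also have "\<dots> \<le> max (- (f (g t) - f x)) 0 / t"
        using t(1) by (intro divide_right_mono) auto
      finally show ?thesis using gt d t x by (intro bexI[of _ "g t"]) force+
    qed
    have "slope m f x = 2 * c * ?D" unfolding slope_def
    proof (rule punctured_limsup_eqI[OF x up])
      fix e r :: real assume "e > 0" "r > 0"
      from lo[OF this] show "\<exists>z\<in>mspace m. z \<noteq> x \<and> mdist m x z < r \<and>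
          2 * c * ?D - e \<le> \<bar>f z - f x\<bar> / mdist m x z"
        using le order_trans by meson
    qed
    moreover have "slope_minus m f x = 2 * c * ?D" unfolding slope_minus_def
    proof (rule punctured_limsup_eqI[OF x _ lo])
      fix e :: real assume "e > 0"
      from up[OF this] show "\<exists>r>0. \<forall>z\<in>mspace m. z \<noteq> x \<longrightarrow> mdist m x z < r \<longrightarrow>
          max (- (f z - f x)) 0 / mdist m x z \<le> 2 * c * ?D + e"
        using le order_trans by meson
    qed
    ultimately show ?thesis ..
  qed
  then show "slope m f x = 2 * c * ?D" "slope_minus m f x = 2 * c * ?D" by auto
qed

text \<open>This makes the parabola an admissible first component of a test function in every space
  of the sequence, wherever its centre lies.\<close>

lemma C1_minus_sqdist:
  assumes geo: "complete_geodesic_space (mspace m) (mdist m)" and y: "y \<in> mspace m" and c: "c \<ge> 0"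
  shows "C1_minus m (\<lambda>z. c * (mdist m z y)\<^sup>2)"
proof -
  let ?f = "\<lambda>z. c * (mdist m z y)\<^sup>2"
  have "locally_Lipschitz m ?f"
    unfolding locally_Lipschitz_iff
  proof (intro ballI exI conjI impI)
    fix x z w assume x: "x \<in> mspace m" and z: "z \<in> mspace m" "mdist m x z < 1"
      and w: "w \<in> mspace m" "mdist m x w < 1"
    have "\<bar>?f z - ?f w\<bar> \<le> c * (mdist m z w * (mdist m z y + mdist m w y))"
      using abs_mdist_diff_le[OF z(1) w(1) y] c by (intro abs_power2_diff_le) auto
    also have "\<dots> \<le> c * (mdist m z w * (2 * mdist m x y + 2))"
      using abs_mdist_diff_le[OF z(1) x y] abs_mdist_diff_le[OF w(1) x y] z w c
      by (intro mult_left_mono) (auto simp: mdist_commute)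
    finally show "\<bar>?f z - ?f w\<bar> \<le> (c * (2 * mdist m x y + 2)) * mdist m z w" by (simp add: mult_ac)
  qed simp
  moreover have "continuous_map (mtopology_of m) euclideanreal (slope m ?f)"
  proof (rule continuous_map_eq)
    have "Lipschitz_continuous_map m euclidean_metric (\<lambda>x. 2 * c * mdist m x y)"
      unfolding Lipschitz_continuous_map_def
    proof (intro conjI exI ballI)
      fix x z assume "x \<in> mspace m" "z \<in> mspace m"
      then have "2 * c * \<bar>mdist m x y - mdist m z y\<bar> \<le> 2 * c * mdist m x z"
        using abs_mdist_diff_le[of x m z y] y c by (intro mult_left_mono) auto
      then show "mdist euclidean_metric (2 * c * mdist m x y) (2 * c * mdist m z y)
          \<le> 2 * c * mdist m x z"
        using c by (simp add: dist_real_def abs_mult flip: right_diff_distrib)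
    qed simp
    then show "continuous_map (mtopology_of m) euclideanreal (\<lambda>x. 2 * c * mdist m x y)"
      using Lipschitz_continuous_imp_continuous_map by fastforce
    show "2 * c * mdist m x y = slope m ?f x" if "x \<in> topspace (mtopology_of m)" for x
      using slope_sqdist(1)[OF geo _ y c] that by simp
  qed
  ultimately show ?thesis
    using slope_sqdist[OF geo _ y c] by (simp add: C1_minus_def)
qed

section \<open>Ekeland's principle for an upper semicontinuous function on a closed ball\<close>

text \<open>An iteration moves from each point to a nearly best point among those reached with gain
  at least \<open>l\<close> per unit distance. Bounded total gain bounds the distances travelled, so
  completeness yields a limit, from which no such improving move to a different point
  remains.\<close>

lemma Ekeland_mcball:
  assumes complete: "mcomplete_of m" and usc: "usc_map (mtopology_of m) f"
    and x0: "x0 \<in> mspace m" and s: "s \<ge> 0" and l: "l > 0"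
    and bd: "\<And>z. z \<in> mcball_of m x0 s \<Longrightarrow> f z \<le> C"
  obtains z where "z \<in> mcball_of m x0 s" "f x0 \<le> f z"
    "\<And>y. y \<in> mcball_of m x0 s \<Longrightarrow> f y - l * mdist m y z \<le> f z"
proof -
  let ?S = "mcball_of m x0 s"
  \<comment> \<open>\<open>y \<in> T x\<close> is Ekeland's order: the gain from \<open>x\<close> to
    \<open>y\<close> pays for the distance at rate \<open>l\<close>. It is transitive by the
    triangle inequality.\<close>
  define T where "T x = {y \<in> ?S. f x + l * mdist m y x \<le> f y}" for x
  have T_trans: "z \<in> T x" if "z \<in> T y" "y \<in> T x" "x \<in> ?S" for x y z
  proof -
    have "l * mdist m z x \<le> l * (mdist m z y + mdist m y x)"
      using that mdist_triangle[of z m y x] l by (intro mult_left_mono) (auto simp: T_def)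
    then show ?thesis using that by (simp add: T_def distrib_left)
  qed
  have step: "\<exists>y\<in>T x. \<forall>y'\<in>T x. f y' \<le> f y + (1/2)^k" if x: "x \<in> ?S" for x k
  proof -
    have xT: "x \<in> T x" using x by (simp add: T_def)
    have bdd: "bdd_above (f ` T x)" using bd by (auto simp: T_def bdd_above_def)
    have "Sup (f ` T x) - (1/2)^k < Sup (f ` T x)" by simp
    then obtain y where "y \<in> T x" "Sup (f ` T x) - (1/2)^k < f y"
      using less_cSUP_iff[OF _ bdd] xT by blast
    moreover have "f y' \<le> Sup (f ` T x)" if "y' \<in> T x" for y' by (rule cSUP_upper[OF that bdd])
    ultimately show ?thesis by (meson less_eq_real_def diff_le_eq order_trans)
  qed
  define nxt where "nxt k x = (SOME y. y \<in> T x \<and> (\<forall>y'\<in>T x. f y' \<le> f y + (1/2)^k))" for k x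
  have nxt: "nxt k x \<in> T x" "\<And>y'. y' \<in> T x \<Longrightarrow> f y' \<le> f (nxt k x) + (1/2)^k" if "x \<in> ?S" for k x
    using someI_ex[OF step[OF that, of k, unfolded Bex_def]] unfolding nxt_def by auto
  define z where "z = rec_nat x0 nxt"
  have z0: "z 0 = x0" and zS: "z (Suc k) = nxt k (z k)" for k by (simp_all add: z_def)
  have zin: "z k \<in> ?S" for k
  proof (induction k)
    case (Suc k) then show ?case using nxt(1)[of "z k" k] by (simp add: zS T_def)
  qed (use x0 s z0 in simp)
  then have zM: "z k \<in> mspace m" for k by simp
  have zT: "z (k + j) \<in> T (z k)" for k j
  proof (induction j)
    case 0 then show ?case using zin[of k] by (simp add: T_def)
  next
    case (Suc j)
    then show ?case using T_trans[OF nxt(1)[OF zin] Suc zin] by (simp add: zS)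
  qed
  have mono: "f (z k) + l * mdist m (z j) (z k) \<le> f (z j)" if "k \<le> j" for k j
    using zT[of k "j - k"] that by (simp add: T_def)
  \<comment> \<open>The values increase and stay below \<open>C\<close>, hence converge. Since
    \<open>l\<close> times a distance is at most the corresponding gain, the points then form a
    Cauchy sequence.\<close>
  have "incseq (\<lambda>k. f (z k))"
    using mono l by (intro monoI) (smt (verit) mdist_nonneg mult_nonneg_nonneg)
  then have conv: "convergent (\<lambda>k. f (z k))"
    using bd[OF zin] by (metis incseq_convergent convergentI)
  have "Metric_space.MCauchy (mspace m) (mdist m) z"
    unfolding Metric_space.MCauchy_def[OF Metric_space_mspace_mdist]
  proof (intro conjI allI impI)
    fix e :: real assume e: "e > 0"
    obtain N where N: "\<And>j k. j \<ge> N \<Longrightarrow> k \<ge> N \<Longrightarrow> \<bar>f (z j) - f (z k)\<bar> < l * e"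
      using conv[THEN convergent_Cauchy] e l unfolding Cauchy_def dist_real_def
      by (metis mult_pos_pos)
    have "mdist m (z j) (z k) < e" if "N \<le> j" "N \<le> k" for j k
    proof -
      have "l * mdist m (z j) (z k) \<le> \<bar>f (z j) - f (z k)\<bar>"
        using mono[of j k] mono[of k j] by (cases "j \<le> k") (auto simp: mdist_commute)
      also have "\<dots> < l * e" using N that by simp
      finally show ?thesis using l by simp
    qed
    then show "\<exists>N. \<forall>n n'. N \<le> n \<longrightarrow> N \<le> n' \<longrightarrow> mdist m (z n) (z n') < e" by blast
  qed (use zM in auto)
  then obtain w where "limitin (Metric_space.mtopology (mspace m) (mdist m)) z w sequentially"
    using complete unfolding mcomplete_of_def
      Metric_space.mcomplete_def[OF Metric_space_mspace_mdist] by blast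
  then have w: "w \<in> mspace m" and "\<And>e. e > 0 \<Longrightarrow> \<forall>\<^sub>F k in sequentially. mdist m (z k) w < e"
    unfolding Metric_space.limitin_metric[OF Metric_space_mspace_mdist]
    by (auto elim: eventually_mono)
  then have lim: "(\<lambda>k. mdist m (z k) w) \<longlonglongrightarrow> 0"
    by (intro order_tendstoI) (auto intro: always_eventually less_le_trans[OF _ mdist_nonneg])
  have limd: "(\<lambda>k. mdist m (z k) a) \<longlonglongrightarrow> mdist m w a" if "a \<in> mspace m" for a
  proof (rule Lim_transform)
    have "\<bar>mdist m (z k) a - mdist m w a\<bar> \<le> mdist m (z k) w" for k
      by (rule abs_mdist_diff_le[OF zM w that])
    then show "(\<lambda>k. mdist m (z k) a - mdist m w a) \<longlonglongrightarrow> 0"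
      by (intro Lim_null_comparison[OF _ lim]) auto
  qed simp
  \<comment> \<open>Upper semicontinuity bounds \<open>f (z j)\<close> by \<open>f w + e\<close> for
    large \<open>j\<close>, which is the direction needed to carry the gain inequality to the limit
    \<open>w\<close>.\<close>
  have fw: "f (z k) + l * mdist m w (z k) \<le> f w" for k
  proof (rule field_le_epsilon)
    fix e :: real assume "e > 0"
    then obtain r where r: "r > 0" "\<forall>y\<in>mspace m. mdist m w y < r \<longrightarrow> f y < f w + e"
      using usc w unfolding usc_map_iff by (metis less_add_same_cancel1)
    have "\<forall>\<^sub>F j in sequentially. f (z k) + l * mdist m (z j) (z k) \<le> f w + e"
      using order_tendstoD(2)[OF lim r(1)] eventually_ge_at_top[of k]
    proof eventually_elim
      case (elim j)
      then show ?case using mono[of k j] r(2) zM[of j] by (fastforce simp: mdist_commute)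
    qed
    moreover have "(\<lambda>j. f (z k) + l * mdist m (z j) (z k)) \<longlonglongrightarrow> f (z k) + l * mdist m w (z k)"
      by (intro tendsto_intros limd zM)
    ultimately show "f (z k) + l * mdist m w (z k) \<le> f w + e"
      using tendsto_upperbound trivial_limit_sequentially by blast
  qed
  have wS: "w \<in> ?S"
  proof -
    have "(\<lambda>k. mdist m (z k) x0) \<longlonglongrightarrow> mdist m w x0" by (rule limd[OF x0])
    then have "mdist m w x0 \<le> s"
      using zin by (intro LIMSEQ_le_const2) (auto simp: mdist_commute)
    then show ?thesis using w x0 by (simp add: mdist_commute)
  qed
  show thesis
  proof
    show "w \<in> ?S" by (rule wS)
    have "0 \<le> l * mdist m w x0" using l by simp
    then show "f x0 \<le> f w" using fw[of 0] z0 by simp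
    fix y assume y: "y \<in> ?S"
    show "f y - l * mdist m y w \<le> f w"
    proof (rule ccontr)
      assume "\<not> ?thesis"
      then have gt: "f w + l * mdist m y w < f y" by simp
      \<comment> \<open>A point \<open>y\<close> violating the claim lies in \<open>T w\<close>,
        hence in every \<open>T (z k)\<close>, and near-optimality of each choice bounds its
        value.\<close>
      have "f y \<le> f w + (1/2)^k" for k
      proof -
        have "w \<in> T (z k)" "y \<in> T w" using fw[of k] wS y gt by (auto simp: T_def)
        then have "y \<in> T (z k)" using T_trans zin by blast
        then have "f y \<le> f (z (Suc k)) + (1/2)^k" using nxt(2)[OF zin] by (simp add: zS)
        moreover have "f (z (Suc k)) \<le> f w" using fw[of "Suc k"] l
          by (smt (verit) mdist_nonneg mult_nonneg_nonneg)
        ultimately show ?thesis by simp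
      qed
      moreover have "(\<lambda>k. f w + (1/2)^k) \<longlonglongrightarrow> f w + 0"
        by (intro tendsto_intros) auto
      ultimately have "f y \<le> f w + 0" by (intro LIMSEQ_le_const) auto
      moreover have "0 \<le> l * mdist m y w" using l by simp
      ultimately show False using gt by simp
    qed
  qed
qed

subsection \<open>The intrinsic metric and the duality of sub- and supersolutions\<close>

text \<open>The two-point partition of the parameter interval already contributes the ambient
  distance to every curve length. Finiteness of the infimum is needed because
  \<open>enn2real\<close> sends infinity to 0.\<close>

lemma dist_le_intrinsic_dist:
  assumes "Metric_space X (intrinsic_dist X)" "x \<in> X" "y \<in> X"
  shows "dist x y \<le> intrinsic_dist X x y"
proof -
  have "ennreal (dist x y) \<le> intrinsic_edist X x y"
    unfolding intrinsic_edist_def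
  proof (rule INF_greatest)
    fix g :: "real \<Rightarrow> 'a"
    assume "g \<in> {g. path g \<and> path_image g \<subseteq> X \<and> pathstart g = x \<and> pathfinish g = y}"
    then have "g 0 = x" "g 1 = y" by (auto simp: pathstart_def pathfinish_def)
    then show "ennreal (dist x y) \<le> curve_length g"
      unfolding curve_length_def by (intro SUP_upper2[of "[0, 1]"]) auto
  qed
  then have "enn2real (ennreal (dist x y)) \<le> enn2real (intrinsic_edist X x y)"
    using intrinsic_edist_finite[OF assms] by (intro enn2real_mono) auto
  then show ?thesis by (simp add: intrinsic_dist_def)
qed

section \<open>Change of sign, exchanging sub- and supersolutions\<close>

lemma usc_map_uminus: "usc_map T (\<lambda>x. - f x) \<longleftrightarrow> lsc_map T f"
proof -
  have "{x \<in> topspace T. - f x < c} = {x \<in> topspace T. - c < f x}" for c by auto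
  moreover have "(\<forall>c. openin T {x \<in> topspace T. - c < f x}) \<longleftrightarrow>
      (\<forall>c. openin T {x \<in> topspace T. c < f x})"
    by (metis minus_minus)
  ultimately show ?thesis by (simp add: usc_map_def lsc_map_def)
qed

lemma usc_env_uminus: "usc_env m (\<lambda>x. - u x) x = - lsc_env m u x"
  using ereal_Limsup_uminus[of "nhdsin (mtopology_of m) x" "\<lambda>y. ereal (u y)"]
  by (simp add: usc_env_def lsc_env_def)

lemma slope_uminus: "slope m (\<lambda>x. - u x) = slope m u"
  by (simp add: slope_def fun_eq_iff abs_minus_commute)

lemma slope_minus_uminus: "slope_minus m (\<lambda>x. - u x) = slope_plus m u"
  by (simp add: slope_minus_def slope_plus_def fun_eq_iff)

lemma locally_Lipschitz_uminus: "locally_Lipschitz m (\<lambda>x. - u x) \<longleftrightarrow> locally_Lipschitz m u"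
  by (simp add: locally_Lipschitz_iff abs_minus_commute)

lemma C1_minus_uminus: "C1_minus m (\<lambda>x. - u x) \<longleftrightarrow> C1_plus m u"
  by (simp add: C1_minus_def C1_plus_def locally_Lipschitz_uminus slope_uminus slope_minus_uminus)

lemma Ham_inf_uminus: "Ham_inf (\<lambda>x r p. - H x (- r) p) a x (- w) p = - Ham_sup H a x w p"
  by (simp add: Ham_inf_def Ham_sup_def flip: ereal_INF_uminus_eq)

lemma all_uminus_fun: "(\<forall>f :: 'a \<Rightarrow> real. P f) \<longleftrightarrow> (\<forall>f. P (\<lambda>x. - f x))"
proof
  assume *: "\<forall>f. P (\<lambda>x. - f x)"
  show "\<forall>f. P f"
  proof
    fix f show "P f" using *[rule_format, of "\<lambda>x. - f x"] by simp
  qed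
qed blast

text \<open>Negating both components of the test function turns a local maximum of -u - psi into a
  local minimum of u - psi and exchanges \<open>C1_minus\<close> with \<open>C1_plus\<close>, while
  slopes are unchanged. \<open>all_uminus_fun\<close> performs this change of variable under the two
  quantifiers.\<close>

lemma viscosity_subsolution_uminus:
  "viscosity_subsolution m (\<lambda>x r p. - H x (- r) p) (\<lambda>x. - u x) \<longleftrightarrow> viscosity_supersolution m H u"
proof -
  have le: "- a - (- b - c) \<le> - a' - (- b' - c') \<longleftrightarrow> a' - (b' + c') \<le> a - (b + c)"
    for a b c a' b' c' :: real by linarith
  show ?thesis
    unfolding viscosity_subsolution_def viscosity_supersolution_def
    by (subst all_uminus_fun, subst (2) all_uminus_fun)
      (simp add: usc_env_uminus C1_minus_uminus locally_Lipschitz_uminus slope_uminus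
        Ham_inf_uminus le)
qed

lemma upper_semilimit_uminus: "upper_semilimit X (\<lambda>n x. - u n x) x = - lower_semilimit X u x"
proof -
  have "limsup (\<lambda>n. ereal (- u n (s n))) = - liminf (\<lambda>n. ereal (u n (s n)))" for s :: "nat \<Rightarrow> 'a"
    using ereal_Limsup_uminus[of sequentially "\<lambda>n. ereal (u n (s n))"] by simp
  then show ?thesis by (simp add: upper_semilimit_def lower_semilimit_def ereal_SUP_uminus_eq)
qed

section \<open>Auxiliary facts on sequences and parabolas\<close>

text \<open>Data found only at the indices \<open>r k\<close> are completed to a full sequence with
  the same limit. The assumption on Hamiltonians speaks of full sequences, so it is applied to the
  completion and then restricted to the subsequence.\<close>

lemma tendsto_fill_subseq:
  fixes y s :: "nat \<Rightarrow> 'a::metric_space"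
  assumes r: "strict_mono r" and y: "y \<longlonglongrightarrow> l" and s: "s \<longlonglongrightarrow> l"
  shows "(\<lambda>n. if n \<in> range r then y (inv r n) else s n) \<longlonglongrightarrow> l"
proof (rule metric_LIMSEQ_I)
  fix e :: real assume e: "e > 0"
  obtain K N where K: "\<And>k. k \<ge> K \<Longrightarrow> dist (y k) l < e" and N: "\<And>n. n \<ge> N \<Longrightarrow> dist (s n) l < e"
    using metric_LIMSEQ_D[OF y e] metric_LIMSEQ_D[OF s e] by blast
  have inj: "inj r" using r by (rule strict_mono_imp_inj_on)
  have "dist (if n \<in> range r then y (inv r n) else s n) l < e" if n: "n \<ge> max N (r K)" for n
  proof (cases "n \<in> range r")
    case True
    then obtain k where k: "n = r k" by blast
    then have "K \<le> k" using n strict_mono_less_eq[OF r, of K k] by simp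
    then show ?thesis using K inj by (simp add: k)
  qed (use N n in simp)
  then show "\<exists>no. \<forall>n\<ge>no. dist (if n \<in> range r then y (inv r n) else s n) l < e" by blast
qed

lemma usc_map_of_continuous:
  assumes "continuous_map (mtopology_of m) euclideanreal f"
  shows "usc_map (mtopology_of m) f"
  using openin_continuous_map_preimage[OF assms, of "{..<c}" for c]
  by (auto simp: usc_map_def)

text \<open>The left side is the tangent at \<open>X = t\<close> of the parabola with slope
  \<open>p\<close> there; the difference is a multiple of the square of
  \<open>X - t\<close>.\<close>

lemma mult_power2_ge_tangent:
  fixes p t X :: real
  assumes "0 \<le> p" "0 < t"
  shows "p * X - p * t / 2 \<le> p / (2 * t) * X\<^sup>2"
proof -
  have "p / (2 * t) * X\<^sup>2 - (p * X - p * t / 2) = p / (2 * t) * (X - t)\<^sup>2"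
    using assms by (simp add: field_simps power2_eq_square)
  also have "\<dots> \<ge> 0" using assms by simp
  finally show ?thesis by simp
qed

lemma strict_mono_subseq_exists:
  assumes "\<And>k N :: nat. \<exists>n\<ge>N. P k n"
  obtains r :: "nat \<Rightarrow> nat" where "strict_mono r" "\<And>k. P k (r k)"
proof -
  have "\<exists>r. \<forall>k. P k (r k) \<and> r k < r (Suc k)"
  proof (rule dependent_nat_choice)
    show "\<exists>n. P 0 n" using assms[of 0 0] by blast
    fix n k
    show "\<exists>n'. P (Suc k) n' \<and> n < n'" using assms[of "Suc n" "Suc k"] by (metis Suc_le_lessD)
  qed
  then show thesis using that by (auto simp: strict_mono_Suc_iff)
qed

subsection \<open>Converging sequences of metrics\<close>

text \<open>\<open>dist_le\<close> connects the two notions of nearness: \<open>approx_seqs\<close>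
  refers to the ambient metric, whereas balls, envelopes and slopes refer to the metrics
  \<open>M n\<close>.\<close>

locale converging_metrics =
  fixes M :: "enat \<Rightarrow> 'a::metric_space metric"
  assumes geo: "complete_geodesic_space (mspace (M n)) (mdist (M n))"
    and dist_le: "x \<in> mspace (M n) \<Longrightarrow> y \<in> mspace (M n) \<Longrightarrow> dist x y \<le> mdist (M n) x y"
    and dist_conv: "a \<in> mspace (M \<infinity>) \<Longrightarrow> b \<in> mspace (M \<infinity>) \<Longrightarrow>
      as \<in> approx_seqs (\<lambda>n. mspace (M n)) a \<Longrightarrow> bs \<in> approx_seqs (\<lambda>n. mspace (M n)) b \<Longrightarrow>
      (\<lambda>n. mdist (M (enat n)) (as n) (bs n)) \<longlonglongrightarrow> mdist (M \<infinity>) a b"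
begin

abbreviation seqs :: "'a \<Rightarrow> (nat \<Rightarrow> 'a) set" where
  "seqs \<equiv> approx_seqs (\<lambda>n. mspace (M n))"

lemma seqs_in: "xs \<in> seqs x \<Longrightarrow> xs n \<in> mspace (M (enat n))"
  by (simp add: approx_seqs_def)

lemma mcomplete_M: "mcomplete_of (M n)"
  using geo[of n] by (simp add: complete_geodesic_space_def mcomplete_of_def)

text \<open>Equivalently, points $z_n$ with $d_n(a_n,z_n) \le \delta$, given for infinitely many $n$, agree
  infinitely often with a sequence converging to a point of $X_\infty$. The formulation with
  predicates avoids subsequences.\<close>

definition precompact_at :: "'a \<Rightarrow> (nat \<Rightarrow> 'a) \<Rightarrow> real \<Rightarrow> bool" where
  "precompact_at a as \<delta> \<longleftrightarrow> (\<forall>Q :: nat \<Rightarrow> 'a \<Rightarrow> bool.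
     (\<forall>x\<in>mspace (M \<infinity>). \<forall>xs\<in>seqs x. \<forall>\<^sub>F n in sequentially. Q n (xs n)) \<longrightarrow>
     (\<forall>\<^sub>F n in sequentially. \<forall>z\<in>mspace (M (enat n)). mdist (M (enat n)) (as n) z \<le> \<delta> \<longrightarrow> Q n z))"

text \<open>If every radius \<rho> k failed with some property \<open>Q k\<close>, functions large
  at the violating points would contradict the ball hypothesis with limit function 0: their suprema
  on the ball of radius \<rho> k would be at least \<rho> k infinitely often. As the admissible
  radii are known only after the functions, all \<open>k\<close> are built into one family.\<close>

lemma precompact_at_exists:
  assumes a: "a \<in> mspace (M \<infinity>)" and as: "as \<in> seqs a"
    and hyp: "\<And>(\<phi> :: nat \<Rightarrow> 'a \<Rightarrow> real) \<phi>_inf.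
      (\<And>n. usc_map (mtopology_of (M (enat n))) (\<phi> n)) \<Longrightarrow> usc_map (mtopology_of (M \<infinity>)) \<phi>_inf \<Longrightarrow>
      (\<And>x xs. x \<in> mspace (M \<infinity>) \<Longrightarrow> xs \<in> seqs x \<Longrightarrow>
        limsup (\<lambda>n. ereal (\<phi> n (xs n))) \<le> ereal (\<phi>_inf x)) \<Longrightarrow>
      \<exists>\<delta>>0. \<forall>r. 0 < r \<longrightarrow> r < \<delta> \<longrightarrow>
        limsup (\<lambda>n. SUP y\<in>mcball_of (M (enat n)) (as n) r. ereal (\<phi> n y))
          \<le> (SUP y\<in>mcball_of (M \<infinity>) a r. ereal (\<phi>_inf y))"
  shows "\<exists>\<delta>>0. precompact_at a as \<delta>"
proof (rule ccontr)
  assume no: "\<not> ?thesis"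
  define \<rho> where "\<rho> k = inverse (real (Suc k))" for k
  have \<rho>: "\<rho> k > 0" for k by (simp add: \<rho>_def)
  define good where "good Q \<longleftrightarrow> (\<forall>x\<in>mspace (M \<infinity>). \<forall>xs\<in>seqs x. \<forall>\<^sub>F n in sequentially. Q n (xs n))"
    for Q :: "nat \<Rightarrow> 'a \<Rightarrow> bool"
  define hit where "hit k Q \<longleftrightarrow> (\<exists>\<^sub>F n in sequentially. \<exists>z\<in>mspace (M (enat n)).
      mdist (M (enat n)) (as n) z \<le> \<rho> k \<and> \<not> Q n z)" for k :: nat and Q :: "nat \<Rightarrow> 'a \<Rightarrow> bool"
  have "\<exists>Q. good Q \<and> hit k Q" for k
  proof -
    have "\<not> precompact_at a as (\<rho> k)" using no \<rho> by blast
    then obtain Q where "good Q" "\<not> (\<forall>\<^sub>F n in sequentially. \<forall>z\<in>mspace (M (enat n)).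
        mdist (M (enat n)) (as n) z \<le> \<rho> k \<longrightarrow> Q n z)"
      unfolding precompact_at_def good_def by blast
    then have "good Q \<and> hit k Q" unfolding hit_def not_eventually by (simp add: Bex_def)
    then show ?thesis by blast
  qed
  then obtain Q where Q: "\<And>k. good (Q k) \<and> hit k (Q k)" using choice[of "\<lambda>k Q. good Q \<and> hit k Q"] by blast
  have Q1: "\<And>k x xs. x \<in> mspace (M \<infinity>) \<Longrightarrow> xs \<in> seqs x \<Longrightarrow> \<forall>\<^sub>F n in sequentially. Q k n (xs n)"
    using Q unfolding good_def by blast
  have Q2: "\<And>k. \<exists>\<^sub>F n in sequentially. \<exists>z\<in>mspace (M (enat n)).
      mdist (M (enat n)) (as n) z \<le> \<rho> k \<and> \<not> Q k n z"
    using Q unfolding hit_def by blast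
  define bad where "bad k n z \<longleftrightarrow> z \<in> mspace (M (enat n)) \<and>
    mdist (M (enat n)) (as n) z \<le> \<rho> k \<and> \<not> Q k n z" for k n z
  define z where "z k n = (SOME w. bad k n w)" for k n
  have z: "bad k n (z k n)" if "bad k n w" for k n w
    unfolding z_def using that by (rule someI)
  \<comment> \<open>One bad point is chosen for each pair of \<open>k\<close> and \<open>n\<close>,
    and \<open>k \<le> n\<close> leaves finitely many for each \<open>n\<close>. The functions below
    thus have finite support, and their superlevel sets at positive heights are finite, hence
    closed.\<close>
  define sel where "sel n w k \<longleftrightarrow> k \<le> n \<and> bad k n w \<and> w = z k n" for n w k
  \<comment> \<open>The value \<open>\<rho> k\<close> at the bad points of radius \<open>\<rho> k\<close> tends to $0$ with $k$, so the upper semilimit of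
    \<open>\<phi>\<close> is $0$ although all the radii are treated at once.\<close>
  define \<phi> where "\<phi> n w = (if \<exists>k. sel n w k then \<rho> (LEAST k. sel n w k) else 0)" for n w
  have \<phi>_nonneg: "\<phi> n w \<ge> 0" for n w using \<rho> by (simp add: \<phi>_def less_imp_le)
  have usc: "usc_map (mtopology_of (M (enat n))) (\<phi> n)" for n
    unfolding usc_map_def
  proof
    fix c
    let ?m = "M (enat n)"
    have Hausdorff: "Hausdorff_space (mtopology_of ?m)"
      unfolding mtopology_of_def
      by (rule Metric_space.Hausdorff_space_mtopology[OF Metric_space_mspace_mdist])
    have "finite {w \<in> mspace ?m. c \<le> \<phi> n w}" if "c > 0"
      by (rule finite_subset[of _ "(\<lambda>k. z k n) ` {..n}"])
        (use that in \<open>auto simp: \<phi>_def sel_def split: if_splits\<close>)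
    then have "closedin (mtopology_of ?m) {w \<in> mspace ?m. c \<le> \<phi> n w}" if "c > 0"
      using that Hausdorff by (intro closedin_Hausdorff_finite) auto
    then have "openin (mtopology_of ?m) (mspace ?m - {w \<in> mspace ?m. c \<le> \<phi> n w})" if "c > 0"
      using that by (metis openin_diff openin_topspace topspace_mtopology_of)
    moreover have "mspace ?m - {w \<in> mspace ?m. c \<le> \<phi> n w} = {w \<in> mspace ?m. \<phi> n w < c}" by auto
    moreover have "{w \<in> mspace ?m. \<phi> n w < c} = {}" if "\<not> c > 0"
      using that \<phi>_nonneg by (auto simp: not_less) (meson not_le order_trans)
    ultimately show "openin (mtopology_of ?m) {w \<in> topspace (mtopology_of ?m). \<phi> n w < c}"
      unfolding topspace_mtopology_of by (metis openin_empty)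
  qed
  have lim: "limsup (\<lambda>n. ereal (\<phi> n (xs n))) \<le> ereal 0" if x: "x \<in> mspace (M \<infinity>)" "xs \<in> seqs x" for x xs
  proof (rule ereal_le_epsilon2)
    fix e :: real assume "e > 0"
    \<comment> \<open>The finitely many properties \<open>Q k\<close> with \<open>k < K\<close>
      eventually hold along the sequence, so a selected index at \<open>xs n\<close> is at least
      \<open>K\<close> and the value is at most \<rho> K.\<close>
    then obtain K where K: "\<rho> K < e" using reals_Archimedean unfolding \<rho>_def by blast
    have "\<forall>\<^sub>F n in sequentially. \<forall>k\<in>{..<K}. Q k n (xs n)"
      by (intro eventually_ball_finite) (use Q1[OF x] in auto)
    then have "\<forall>\<^sub>F n in sequentially. ereal (\<phi> n (xs n)) \<le> ereal 0 + ereal e"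
    proof eventually_elim
      case (elim n)
      show ?case
      proof (cases "\<exists>k. sel n (xs n) k")
        case True
        define k where "k = (LEAST k. sel n (xs n) k)"
        have "sel n (xs n) k" using True unfolding k_def by (rule LeastI_ex)
        then have "\<not> Q k n (xs n)" unfolding sel_def bad_def by blast
        then have "K \<le> k" using elim by force
        then have "\<rho> k \<le> \<rho> K" by (simp add: \<rho>_def le_imp_inverse_le)
        moreover have "\<phi> n (xs n) = \<rho> k" using True by (simp add: \<phi>_def k_def)
        ultimately show ?thesis using K by simp
      next
        case False
        then show ?thesis using \<open>e > 0\<close> by (simp add: \<phi>_def)
      qed
    qed
    then show "limsup (\<lambda>n. ereal (\<phi> n (xs n))) \<le> ereal 0 + ereal e" by (rule Limsup_bounded)
  qed
  have "usc_map (mtopology_of (M \<infinity>)) (\<lambda>x. 0)"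
    unfolding usc_map_iff by (blast intro: zero_less_one)
  have "\<exists>\<delta>>0. \<forall>r. 0 < r \<longrightarrow> r < \<delta> \<longrightarrow>
      limsup (\<lambda>n. SUP y\<in>mcball_of (M (enat n)) (as n) r. ereal (\<phi> n y))
        \<le> (SUP y\<in>mcball_of (M \<infinity>) a r. ereal 0)"
    by (rule hyp[of \<phi>, OF usc \<open>usc_map _ (\<lambda>x. 0)\<close>]) (rule lim)
  then obtain \<delta> where \<delta>: "\<delta> > 0"
    and sup: "\<And>r. 0 < r \<Longrightarrow> r < \<delta> \<Longrightarrow>
      limsup (\<lambda>n. SUP y\<in>mcball_of (M (enat n)) (as n) r. ereal (\<phi> n y))
        \<le> (SUP y\<in>mcball_of (M \<infinity>) a r. ereal 0)"
    by blast
  obtain k where k: "\<rho> k < \<delta>" using reals_Archimedean[OF \<delta>] unfolding \<rho>_def by blast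
  have "(SUP y\<in>mcball_of (M \<infinity>) a (\<rho> k). ereal 0) \<le> ereal 0" by (rule SUP_least) simp
  then have "limsup (\<lambda>n. SUP y\<in>mcball_of (M (enat n)) (as n) (\<rho> k). ereal (\<phi> n y)) < ereal (\<rho> k)"
    using sup[OF \<rho> k] \<rho>[of k] by (meson ereal_less(2) less_ereal.simps(1) order_le_less_trans)
  then have "\<forall>\<^sub>F n in sequentially.
      (SUP y\<in>mcball_of (M (enat n)) (as n) (\<rho> k). ereal (\<phi> n y)) < ereal (\<rho> k)"
    by (rule Limsup_lessD)
  with eventually_ge_at_top[of k]
  have "\<forall>\<^sub>F n in sequentially. \<not> (\<exists>w. bad k n w)"
  proof eventually_elim
    case (elim n)
    show ?case
    proof
      assume "\<exists>w. bad k n w"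
      then have b: "bad k n (z k n)" using z by blast
      then have s: "sel n (z k n) k" using elim(1) by (simp add: sel_def)
      \<comment> \<open>The point may also be selected for a smaller index; the least index then
        gives an even larger value, since \<rho> is decreasing.\<close>
      then have "(LEAST k'. sel n (z k n) k') \<le> k" by (rule Least_le)
      then have "\<rho> k \<le> \<phi> n (z k n)" using s by (auto simp: \<phi>_def \<rho>_def intro: le_imp_inverse_le)
      moreover have "ereal (\<phi> n (z k n)) \<le>
          (SUP y\<in>mcball_of (M (enat n)) (as n) (\<rho> k). ereal (\<phi> n y))"
        by (rule SUP_upper) (use b seqs_in[OF as] in \<open>simp add: bad_def\<close>)
      ultimately show False using elim(2) by (meson ereal_less_eq(3) not_le order_trans)
    qed
  qed
  then show False using Q2[of k] unfolding frequently_def bad_def Bex_def by simp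
qed

text \<open>The semilimit is built from \<open>u n\<close>, the viscosity inequality from its
  envelope. The envelope at \<open>xs n\<close> is nearly attained by \<open>u n\<close> at a point
  within \<rho> n, and by \<open>dist_le\<close> these points again converge to \<open>x\<close>; so
  passing to envelopes does not raise the upper semilimit.\<close>

lemma eventually_usc_env_less:
  assumes fin: "\<And>n x. x \<in> mspace (M (enat n)) \<Longrightarrow> \<bar>usc_env (M (enat n)) (u n) x\<bar> \<noteq> \<infinity>"
    and xs: "xs \<in> seqs x" and less: "upper_semilimit (\<lambda>n. mspace (M n)) u x < ereal c"
  shows "\<forall>\<^sub>F n in sequentially. real_of_ereal (usc_env (M (enat n)) (u n) (xs n)) < c"
proof -
  define w where "w n z = real_of_ereal (usc_env (M (enat n)) (u n) z)" for n z
  define \<rho> where "\<rho> n = inverse (real (Suc n))" for n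
  have \<rho>: "\<rho> n > 0" "\<rho> \<longlonglongrightarrow> 0" for n
    unfolding \<rho>_def using LIMSEQ_inverse_real_of_nat by simp_all
  have "\<exists>y. y \<in> mspace (M (enat n)) \<and> mdist (M (enat n)) (xs n) y < \<rho> n \<and> w n (xs n) - \<rho> n < u n y" for n
  proof -
    have "ereal (w n (xs n) - \<rho> n) < usc_env (M (enat n)) (u n) (xs n)"
      using fin[OF seqs_in[OF xs], of n] \<rho>(1)[of n] unfolding w_def
      by (cases "usc_env (M (enat n)) (u n) (xs n)") auto
    then show ?thesis using less_usc_envD[OF seqs_in[OF xs] _ \<rho>(1)] by metis
  qed
  then obtain ys where "\<forall>n. ys n \<in> mspace (M (enat n)) \<and> mdist (M (enat n)) (xs n) (ys n) < \<rho> n \<and>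
      w n (xs n) - \<rho> n < u n (ys n)"
    using choice[of "\<lambda>n y. y \<in> mspace (M (enat n)) \<and> mdist (M (enat n)) (xs n) y < \<rho> n \<and>
      w n (xs n) - \<rho> n < u n y"] by blast
  then have ys: "\<And>n. ys n \<in> mspace (M (enat n))"
    "\<And>n. mdist (M (enat n)) (xs n) (ys n) < \<rho> n" "\<And>n. w n (xs n) - \<rho> n < u n (ys n)"
    by auto
  have "dist (ys n) x \<le> \<rho> n + dist (xs n) x" for n
  proof -
    have "dist (xs n) (ys n) \<le> \<rho> n"
      by (rule order_trans[OF dist_le[OF seqs_in[OF xs] ys(1)] less_imp_le[OF ys(2)]])
    then show ?thesis using dist_triangle[of "ys n" x "xs n"] by (simp add: dist_commute)
  qed
  moreover have "xs \<longlonglongrightarrow> x" using xs by (simp add: approx_seqs_def)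
  then have "(\<lambda>n. dist (xs n) x) \<longlonglongrightarrow> 0" by (rule tendsto_dist_iff[THEN iffD1])
  from tendsto_add[OF \<rho>(2) this] have "(\<lambda>n. \<rho> n + dist (xs n) x) \<longlonglongrightarrow> 0" by simp
  ultimately have "(\<lambda>n. dist (ys n) x) \<longlonglongrightarrow> 0"
    by (intro Lim_null_comparison[of "\<lambda>n. dist (ys n) x"]) auto
  then have "ys \<longlonglongrightarrow> x" by (rule tendsto_dist_iff[THEN iffD2])
  then have "ys \<in> seqs x" using ys(1) by (simp add: approx_seqs_def)
  then have le: "limsup (\<lambda>n. ereal (u n (ys n))) \<le> upper_semilimit (\<lambda>n. mspace (M n)) u x"
    unfolding upper_semilimit_def by (rule SUP_upper)
  \<comment> \<open>The gap between \<open>c'\<close> and \<open>c\<close> absorbs the error \<rho>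
    n.\<close>
  obtain c' where c': "upper_semilimit (\<lambda>n. mspace (M n)) u x < ereal c'" "c' < c"
    using ereal_dense2[OF less] by auto
  have "\<forall>\<^sub>F n in sequentially. ereal (u n (ys n)) < ereal c'"
    by (rule Limsup_lessD) (use le c' in simp)
  moreover have "\<forall>\<^sub>F n in sequentially. \<rho> n < c - c'"
    by (rule order_tendstoD(2)[OF \<rho>(2)]) (use c' in simp)
  ultimately have "\<forall>\<^sub>F n in sequentially. w n (xs n) < c"
    by eventually_elim (use ys(3) in \<open>smt (verit) less_ereal.simps(1)\<close>)
  then show ?thesis by (simp add: w_def)
qed

section \<open>Transfer of the maximum to the approximating spaces\<close>

text \<open>The test function on the limit space is the parabola centred at \<open>y\<close> plus a
  cone of opening \<open>b\<close> at \<open>a\<close>. By \<open>strict\<close> its values on the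
  sphere of radius \<open>s\<close> leave a gap \<mu>; the gap survives in X_n and keeps the point
  found by Ekeland's principle off the boundary. The number \<open>e\<close> is its distance to the
  approximation of \<open>y\<close>, so \<open>2 * c * e\<close> is the slope of the parabola
  there.\<close>

lemma exists_approximate_solution:
  fixes u :: "nat \<Rightarrow> 'a \<Rightarrow> real" and H :: "enat \<Rightarrow> 'a \<Rightarrow> real \<Rightarrow> real \<Rightarrow> real"
  assumes sub: "\<And>n. viscosity_subsolution (M (enat n)) (H (enat n)) (u n)"
    and v: "\<And>x. x \<in> mspace (M \<infinity>) \<Longrightarrow> upper_semilimit (\<lambda>n. mspace (M n)) u x = ereal (v x)"
    and a: "a \<in> mspace (M \<infinity>)" and as: "as \<in> seqs a" and pre: "precompact_at a as \<delta>"
    and y: "y \<in> mspace (M \<infinity>)" and c: "0 \<le> c" and b: "0 \<le> b" and s: "0 < s" "s < \<delta>"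
    and W: "\<And>x. x \<in> mspace (M \<infinity>) \<Longrightarrow> mdist (M \<infinity>) a x \<le> s \<Longrightarrow> v x \<le> W"
    and strict: "\<And>x. x \<in> mspace (M \<infinity>) \<Longrightarrow> mdist (M \<infinity>) a x = s \<Longrightarrow>
      v x - c * (mdist (M \<infinity>) x y)\<^sup>2 - b * s + \<mu> \<le> v a - c * (mdist (M \<infinity>) a y)\<^sup>2"
    and \<mu>: "0 < \<mu>" and \<tau>: "0 < \<tau>"
  shows "\<exists>n\<ge>N. \<exists>z\<in>mspace (M (enat n)). \<exists>w p e. 0 \<le> p \<and> dist z a \<le> s + \<tau> \<and> w < W + \<tau> \<and>
    \<bar>e - mdist (M \<infinity>) a y\<bar> \<le> s + \<tau> \<and> v a - \<tau> + (c * e\<^sup>2 - c * (mdist (M \<infinity>) a y)\<^sup>2) \<le> w \<and>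
    \<bar>p - 2 * c * e\<bar> \<le> b + \<tau> \<and> H (enat n) z w p \<le> \<tau>"
proof -
  let ?S = "upper_semilimit (\<lambda>n. mspace (M n)) u" and ?D = "mdist (M \<infinity>) a y"
  define w where "w n z = real_of_ereal (usc_env (M (enat n)) (u n) z)" for n z
  have wfin: "\<bar>usc_env (M (enat n)) (u n) z\<bar> \<noteq> \<infinity>" if "z \<in> mspace (M (enat n))" for n z
    using sub[of n] that by (simp add: viscosity_subsolution_def)
  have uw: "u n z \<le> w n z" if "z \<in> mspace (M (enat n))" for n z
    using le_usc_env[OF that, of "u n"] wfin[OF that] unfolding w_def
    by (cases "usc_env (M (enat n)) (u n) z") auto
  have wlim: "\<forall>\<^sub>F n in sequentially. w n (xs n) < k"
    if "x \<in> mspace (M \<infinity>)" "xs \<in> seqs x" "v x < k" for x xs k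
    unfolding w_def using that v by (intro eventually_usc_env_less wfin) auto
  \<comment> \<open>The error \<kappa> is spent twice, on \<open>u n (xs n)\<close> and on the
    parabola at \<open>xs n\<close>. The total is at most \<tau>, for the lower bound on
    \<open>w\<close>, and at most \<open>\<mu> / 2\<close>, for the contradiction on the
    sphere.\<close>
  define \<kappa> where "\<kappa> = min (\<tau> / 2) (\<mu> / 4)"
  have \<kappa>: "\<kappa> > 0" "\<kappa> \<le> \<tau> / 2" "\<kappa> \<le> \<mu> / 4" using \<mu> \<tau> by (auto simp: \<kappa>_def)
  \<comment> \<open>An approximating sequence exists because a supremum over the empty set would be
    minus infinity, whereas \<open>v y\<close> is real.\<close>
  obtain ys where ys: "ys \<in> seqs y"
    using v[OF y] unfolding upper_semilimit_def by (cases "seqs y = {}") (auto simp: bot_ereal_def)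
  \<comment> \<open>The balls in X_n are centred at \<open>xs n\<close>, where \<open>u n\<close>
    nearly reaches \<open>v a\<close> for infinitely many \<open>n\<close>. The given sequence
    \<open>as\<close> serves only to locate these balls inside the precompact ones.\<close>
  have "ereal (v a - \<kappa>) < ?S a" using v[OF a] \<kappa> by simp
  then obtain xs where xs: "xs \<in> seqs a" "ereal (v a - \<kappa>) < limsup (\<lambda>n. ereal (u n (xs n)))"
    unfolding upper_semilimit_def less_SUP_iff by blast
  have freq: "\<exists>\<^sub>F n in sequentially. v a - \<kappa> < u n (xs n)"
  proof (rule ccontr)
    assume "\<not> ?thesis"
    then have "\<forall>\<^sub>F n in sequentially. ereal (u n (xs n)) \<le> ereal (v a - \<kappa>)"
      by (simp add: not_frequently not_less)
    then have "limsup (\<lambda>n. ereal (u n (xs n))) \<le> ereal (v a - \<kappa>)" by (rule Limsup_bounded)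
    then show False using xs(2) by simp
  qed
  have xy: "(\<lambda>n. mdist (M (enat n)) (xs n) (ys n)) \<longlonglongrightarrow> ?D"
    by (rule dist_conv[OF a y xs(1) ys])
  have "(\<lambda>n. mdist (M (enat n)) (as n) (xs n)) \<longlonglongrightarrow> 0"
    using dist_conv[OF a a as xs(1)] a by simp
  then have E1: "\<forall>\<^sub>F n in sequentially. mdist (M (enat n)) (as n) (xs n) < \<delta> - s"
    by (rule order_tendstoD(2)) (use s in simp)
  have "(\<lambda>n. c * (mdist (M (enat n)) (xs n) (ys n))\<^sup>2) \<longlonglongrightarrow> c * ?D\<^sup>2"
    by (intro tendsto_intros xy)
  then have E2: "\<forall>\<^sub>F n in sequentially. c * (mdist (M (enat n)) (xs n) (ys n))\<^sup>2 < c * ?D\<^sup>2 + \<kappa>"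
    by (rule order_tendstoD(2)) (use \<kappa> in simp)
  have E2': "\<forall>\<^sub>F n in sequentially. \<bar>mdist (M (enat n)) (xs n) (ys n) - ?D\<bar> < \<tau>"
    using tendstoD[OF xy \<tau>] by (simp add: dist_real_def)
  have E5: "\<forall>\<^sub>F n in sequentially. dist (xs n) a < \<tau>"
    using tendstoD[OF _ \<tau>] xs(1) by (auto simp: approx_seqs_def)
  have pre': "\<forall>\<^sub>F n in sequentially. \<forall>z\<in>mspace (M (enat n)). mdist (M (enat n)) (as n) z \<le> \<delta> \<longrightarrow> Q n z"
    if "\<And>x zs. x \<in> mspace (M \<infinity>) \<Longrightarrow> zs \<in> seqs x \<Longrightarrow> \<forall>\<^sub>F n in sequentially. Q n (zs n)" for Q
    using pre that unfolding precompact_at_def by blast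
  \<comment> \<open>Precompactness makes the bound uniform on the ball: it has to be checked only
    along convergent sequences. If the limit lies outside the closed ball, the premise on the
    distance eventually fails.\<close>
  have E3: "\<forall>\<^sub>F n in sequentially. \<forall>z\<in>mspace (M (enat n)). mdist (M (enat n)) (as n) z \<le> \<delta> \<longrightarrow>
      (mdist (M (enat n)) (xs n) z \<le> s \<longrightarrow> w n z < W + \<tau>)"
  proof (rule pre')
    fix x zs assume x: "x \<in> mspace (M \<infinity>)" and zs: "zs \<in> seqs x"
    show "\<forall>\<^sub>F n in sequentially. mdist (M (enat n)) (xs n) (zs n) \<le> s \<longrightarrow> w n (zs n) < W + \<tau>"
    proof (cases "mdist (M \<infinity>) a x \<le> s")
      case True
      then have "v x < W + \<tau>" using W[OF x] \<tau> by fastforce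
      from wlim[OF x zs this] show ?thesis by (rule eventually_mono) simp
    next
      case False
      then have "\<forall>\<^sub>F n in sequentially. s < mdist (M (enat n)) (xs n) (zs n)"
        by (intro order_tendstoD(1)[OF dist_conv[OF a x xs(1) zs]]) simp
      then show ?thesis by (rule eventually_mono) simp
    qed
  qed
  \<comment> \<open>Of the gap \<mu>, one quarter is lost to the envelope and one to the parabola,
    leaving one half.\<close>
  have E4: "\<forall>\<^sub>F n in sequentially. \<forall>z\<in>mspace (M (enat n)). mdist (M (enat n)) (as n) z \<le> \<delta> \<longrightarrow>
      (mdist (M (enat n)) (xs n) z = s \<longrightarrow>
        w n z - c * (mdist (M (enat n)) z (ys n))\<^sup>2 - b * s < v a - c * ?D\<^sup>2 - \<mu> / 2)"
  proof (rule pre')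
    fix x zs assume x: "x \<in> mspace (M \<infinity>)" and zs: "zs \<in> seqs x"
    show "\<forall>\<^sub>F n in sequentially. mdist (M (enat n)) (xs n) (zs n) = s \<longrightarrow>
        w n (zs n) - c * (mdist (M (enat n)) (zs n) (ys n))\<^sup>2 - b * s < v a - c * ?D\<^sup>2 - \<mu> / 2"
    proof (cases "mdist (M \<infinity>) a x = s")
      case True
      have "\<forall>\<^sub>F n in sequentially. w n (zs n) < v x + \<mu> / 4"
        using wlim[OF x zs] \<mu> by simp
      moreover have "(\<lambda>n. c * (mdist (M (enat n)) (zs n) (ys n))\<^sup>2) \<longlonglongrightarrow> c * (mdist (M \<infinity>) x y)\<^sup>2"
        by (intro tendsto_intros dist_conv[OF x y zs ys])
      then have "\<forall>\<^sub>F n in sequentially. c * (mdist (M \<infinity>) x y)\<^sup>2 - \<mu> / 4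
          < c * (mdist (M (enat n)) (zs n) (ys n))\<^sup>2"
        by (rule order_tendstoD(1)) (use \<mu> in simp)
      ultimately show ?thesis
        by eventually_elim (use strict[OF x True] in linarith)
    next
      case False
      then have "\<forall>\<^sub>F n in sequentially. mdist (M (enat n)) (xs n) (zs n) \<noteq> s"
        by (intro tendsto_imp_eventually_ne[OF dist_conv[OF a x xs(1) zs]])
      then show ?thesis by (rule eventually_mono) simp
    qed
  qed
  have "\<forall>\<^sub>F n in sequentially. N \<le> n \<and>
      mdist (M (enat n)) (as n) (xs n) < \<delta> - s \<and>
      c * (mdist (M (enat n)) (xs n) (ys n))\<^sup>2 < c * ?D\<^sup>2 + \<kappa> \<and>
      \<bar>mdist (M (enat n)) (xs n) (ys n) - ?D\<bar> < \<tau> \<and> dist (xs n) a < \<tau> \<and>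
      (\<forall>z\<in>mspace (M (enat n)). mdist (M (enat n)) (as n) z \<le> \<delta> \<longrightarrow>
        (mdist (M (enat n)) (xs n) z \<le> s \<longrightarrow> w n z < W + \<tau>)) \<and>
      (\<forall>z\<in>mspace (M (enat n)). mdist (M (enat n)) (as n) z \<le> \<delta> \<longrightarrow>
        (mdist (M (enat n)) (xs n) z = s \<longrightarrow>
          w n z - c * (mdist (M (enat n)) z (ys n))\<^sup>2 - b * s < v a - c * ?D\<^sup>2 - \<mu> / 2))"
    using eventually_ge_at_top[of N] E1 E2 E2' E5 E3 E4 by eventually_elim blast
  \<comment> \<open>Near-optimality of \<open>xs n\<close> holds only for infinitely many
    \<open>n\<close>, all other conditions for all large \<open>n\<close>; hence a common index
    beyond \<open>N\<close> exists.\<close>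
  from frequently_ex[OF frequently_eventually_frequently[OF freq this]]
  obtain n where n: "N \<le> n" and un: "v a - \<kappa> < u n (xs n)"
    and n1: "mdist (M (enat n)) (as n) (xs n) < \<delta> - s"
    and n2: "c * (mdist (M (enat n)) (xs n) (ys n))\<^sup>2 < c * ?D\<^sup>2 + \<kappa>"
    and n2': "\<bar>mdist (M (enat n)) (xs n) (ys n) - ?D\<bar> < \<tau>" and n5: "dist (xs n) a < \<tau>"
    and n3: "\<forall>z\<in>mspace (M (enat n)). mdist (M (enat n)) (as n) z \<le> \<delta> \<longrightarrow>
        (mdist (M (enat n)) (xs n) z \<le> s \<longrightarrow> w n z < W + \<tau>)"
    and n4: "\<forall>z\<in>mspace (M (enat n)). mdist (M (enat n)) (as n) z \<le> \<delta> \<longrightarrow>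
        (mdist (M (enat n)) (xs n) z = s \<longrightarrow>
          w n z - c * (mdist (M (enat n)) z (ys n))\<^sup>2 - b * s < v a - c * ?D\<^sup>2 - \<mu> / 2)"
    by (elim exE conjE) (rule that)
  let ?m = "M (enat n)"
  have asn: "as n \<in> mspace ?m" and xsn: "xs n \<in> mspace ?m" and ysn: "ys n \<in> mspace ?m"
    using seqs_in as xs(1) ys by auto
  have near: "mdist ?m (as n) z \<le> \<delta>" if "z \<in> mspace ?m" "mdist ?m (xs n) z \<le> s" for z
    using mdist_triangle[OF asn xsn that(1)] that(2) n1 by simp
  define \<psi>1 where "\<psi>1 z = c * (mdist ?m z (ys n))\<^sup>2" for z
  define \<Phi> where "\<Phi> z = w n z - (\<psi>1 z + b * mdist ?m z (xs n))" for z
  have C1: "C1_minus ?m \<psi>1" unfolding \<psi>1_def by (rule C1_minus_sqdist[OF geo ysn c])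
  have "usc_map (mtopology_of ?m) (\<lambda>z. w n z - \<psi>1 z - b * mdist ?m z (xs n))"
  proof (intro usc_map_diff)
    show "usc_map (mtopology_of ?m) (w n)" unfolding w_def by (rule usc_map_usc_env[OF wfin])
    show "locally_Lipschitz ?m \<psi>1" using C1 by (simp add: C1_minus_def)
    show "locally_Lipschitz ?m (\<lambda>z. b * mdist ?m z (xs n))"
    proof (rule Lipschitz_imp_locally_Lipschitz)
      fix z z' assume "z \<in> mspace ?m" "z' \<in> mspace ?m"
      then show "\<bar>b * mdist ?m z (xs n) - b * mdist ?m z' (xs n)\<bar> \<le> b * mdist ?m z z'"
        using abs_mdist_diff_le[of z ?m z' "xs n"] xsn b
        by (simp add: abs_mult mult_left_mono flip: right_diff_distrib)
    qed
  qed
  then have usc: "usc_map (mtopology_of ?m) \<Phi>" unfolding \<Phi>_def by (simp add: diff_diff_eq)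
  have bd: "\<Phi> z \<le> W + \<tau>" if "z \<in> mcball_of ?m (xs n) s" for z
  proof -
    have "w n z < W + \<tau>" using that near by (intro n3[rule_format]) auto
    moreover have "0 \<le> \<psi>1 z" "0 \<le> b * mdist ?m z (xs n)" using b c by (auto simp: \<psi>1_def)
    ultimately show ?thesis by (simp add: \<Phi>_def)
  qed
  obtain z where zB: "z \<in> mcball_of ?m (xs n) s" and ge: "\<Phi> (xs n) \<le> \<Phi> z"
    and max: "\<And>y. y \<in> mcball_of ?m (xs n) s \<Longrightarrow> \<Phi> y - \<tau> * mdist ?m y z \<le> \<Phi> z"
    using Ekeland_mcball[OF mcomplete_M usc xsn less_imp_le[OF s(1)] \<tau> bd] by blast
  have z: "z \<in> mspace ?m" "mdist ?m (xs n) z \<le> s" using zB by auto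
  have \<Phi>xs: "v a - \<kappa> - \<kappa> - c * ?D\<^sup>2 < \<Phi> (xs n)"
    using uw[OF xsn] un n2 xsn by (simp add: \<Phi>_def \<psi>1_def)
  have lt: "mdist ?m (xs n) z < s"
  proof (rule ccontr)
    assume "\<not> ?thesis"
    then have eq: "mdist ?m (xs n) z = s" using z(2) by simp
    have "\<Phi> z < v a - c * ?D\<^sup>2 - \<mu> / 2"
      using n4[rule_format, OF z(1) near[OF z] eq] by (simp add: \<Phi>_def \<psi>1_def mdist_commute[of ?m z "xs n"] eq)
    then show False using \<Phi>xs ge \<kappa> by simp
  qed
  \<comment> \<open>The cone and the Ekeland perturbation together form the locally Lipschitz
    component. Its constant \<open>b + \<tau>\<close> bounds the deviation of the momentum from the
    parabola's slope.\<close>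
  define \<psi>2 where "\<psi>2 y = b * mdist ?m y (xs n) + \<tau> * mdist ?m y z" for y
  have Lip2: "\<bar>\<psi>2 y - \<psi>2 y'\<bar> \<le> (b + \<tau>) * mdist ?m y y'" if "y \<in> mspace ?m" "y' \<in> mspace ?m" for y y'
  proof -
    have "\<psi>2 y - \<psi>2 y' = b * (mdist ?m y (xs n) - mdist ?m y' (xs n)) + \<tau> * (mdist ?m y z - mdist ?m y' z)"
      by (simp add: \<psi>2_def right_diff_distrib)
    also have "\<bar>\<dots>\<bar> \<le> \<bar>b * (mdist ?m y (xs n) - mdist ?m y' (xs n))\<bar> + \<bar>\<tau> * (mdist ?m y z - mdist ?m y' z)\<bar>"
      by (rule abs_triangle_ineq)
    also have "\<dots> \<le> b * mdist ?m y y' + \<tau> * mdist ?m y y'"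
      using abs_mdist_diff_le[OF that xsn] abs_mdist_diff_le[OF that z(1)] b \<tau>
      by (simp add: abs_mult add_mono mult_left_mono)
    finally show ?thesis by (simp add: distrib_right)
  qed
  have loc2: "locally_Lipschitz ?m \<psi>2" by (rule Lipschitz_imp_locally_Lipschitz[OF Lip2])
  have locmax: "\<forall>\<^sub>F y in nhdsin (mtopology_of ?m) z. w n y - (\<psi>1 y + \<psi>2 y) \<le> w n z - (\<psi>1 z + \<psi>2 z)"
    unfolding eventually_nhdsin_mdist[OF z(1)]
  proof (intro exI conjI ballI impI)
    show "0 < s - mdist ?m (xs n) z" using lt by simp
    fix y assume y: "y \<in> mspace ?m" "mdist ?m z y < s - mdist ?m (xs n) z"
    then have "y \<in> mcball_of ?m (xs n) s" using mdist_triangle[OF xsn z(1) y(1)] xsn by simp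
    from max[OF this] show "w n y - (\<psi>1 y + \<psi>2 y) \<le> w n z - (\<psi>1 z + \<psi>2 z)"
      using z(1) by (simp add: \<Phi>_def \<psi>2_def)
  qed
  define e where "e = mdist ?m z (ys n)"
  define \<alpha> where "\<alpha> = real_of_ereal (usc_env ?m (slope ?m \<psi>2) z)"
  have "Ham_inf (H (enat n)) \<alpha> z (w n z) (slope ?m \<psi>1 z) \<le> 0"
    using sub[of n] z(1) C1 loc2 locmax unfolding viscosity_subsolution_def w_def \<alpha>_def by blast
  moreover have "slope ?m \<psi>1 z = 2 * c * e"
    unfolding \<psi>1_def e_def by (rule slope_sqdist(1)[OF geo z(1) ysn c])
  \<comment> \<open>The infimum in \<open>Ham_inf\<close> need not be attained; the strict bound by
    \<tau> provides an actual momentum.\<close>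
  ultimately have "Ham_inf (H (enat n)) \<alpha> z (w n z) (2 * c * e) < ereal \<tau>"
    using \<tau> by (simp add: order_le_less_trans)
  then obtain p where p: "0 \<le> p" "\<bar>p - 2 * c * e\<bar> \<le> \<alpha>" "H (enat n) z (w n z) p < \<tau>"
    unfolding Ham_inf_def INF_less_iff by auto
  have "0 \<le> usc_env ?m (slope ?m \<psi>2) z" "usc_env ?m (slope ?m \<psi>2) z \<le> ereal (b + \<tau>)"
    using usc_env_slope_bounds[OF Lip2 z(1), of 1] b \<tau> by auto
  then have \<alpha>: "\<alpha> \<le> b + \<tau>" unfolding \<alpha>_def by (cases "usc_env ?m (slope ?m \<psi>2) z") auto
  have "dist z a \<le> s + \<tau>"
    using dist_triangle[of z a "xs n"] dist_le[OF z(1) xsn] z(2) n5 mdist_commute[of ?m z "xs n"] by simp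
  moreover have "\<bar>e - ?D\<bar> \<le> s + \<tau>"
    using abs_mdist_diff_le[OF z(1) xsn ysn] n2' z(2) 
    unfolding e_def mdist_commute[of ?m z "xs n"] by linarith
  moreover have "v a - \<tau> + (c * e\<^sup>2 - c * ?D\<^sup>2) \<le> w n z"
  proof -
    have "0 \<le> b * mdist ?m z (xs n)" using b by simp
    then show ?thesis using \<Phi>xs ge \<kappa>(2) by (simp add: \<Phi>_def \<psi>1_def e_def)
  qed
  moreover have "w n z < W + \<tau>" by (rule n3[rule_format, OF z(1) near[OF z] z(2)])
  ultimately show ?thesis
    using n z(1) p \<alpha> by (intro exI[of _ n] conjI bexI[of _ z] exI[of _ "w n z"] exI[of _ p] exI[of _ e]) auto
qed

text \<open>Here the arbitrary test function is traded for a parabola and a cone. All error terms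
  are measured against \<epsilon>, so that letting \<epsilon> tend to 0 recovers the exact interval
  of momenta around \<open>p\<close>.\<close>

lemma approximate_solution_near_max:
  fixes u :: "nat \<Rightarrow> 'a \<Rightarrow> real" and H :: "enat \<Rightarrow> 'a \<Rightarrow> real \<Rightarrow> real \<Rightarrow> real"
  assumes sub: "\<And>n. viscosity_subsolution (M (enat n)) (H (enat n)) (u n)"
    and v: "\<And>x. x \<in> mspace (M \<infinity>) \<Longrightarrow> upper_semilimit (\<lambda>n. mspace (M n)) u x = ereal (v x)"
    and usc: "usc_map (mtopology_of (M \<infinity>)) v"
    and a: "a \<in> mspace (M \<infinity>)" and as: "as \<in> seqs a" and pre: "precompact_at a as \<delta>" and \<delta>: "\<delta> > 0"
    and C1: "C1_minus (M \<infinity>) \<psi>1" and loc: "locally_Lipschitz (M \<infinity>) \<psi>2"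
    and locmax: "\<forall>\<^sub>F y in nhdsin (mtopology_of (M \<infinity>)) a. v y - (\<psi>1 y + \<psi>2 y) \<le> v a - (\<psi>1 a + \<psi>2 a)"
    and \<epsilon>: "\<epsilon> > 0"
  defines "p \<equiv> slope (M \<infinity>) \<psi>1 a" and "\<alpha> \<equiv> real_of_ereal (usc_env (M \<infinity>) (slope (M \<infinity>) \<psi>2) a)"
  shows "\<exists>n\<ge>N. \<exists>z\<in>mspace (M (enat n)). \<exists>w q. 0 \<le> q \<and> dist z a < \<epsilon> \<and> \<bar>w - v a\<bar> < \<epsilon> \<and>
    \<bar>q - p\<bar> \<le> \<alpha> + \<epsilon> \<and> H (enat n) z w q \<le> \<epsilon>"
proof -
  let ?m = "M \<infinity>"
  let ?d = "mdist ?m"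
  have loc1: "locally_Lipschitz ?m \<psi>1" using C1 by (simp add: C1_minus_def)
  have p: "0 \<le> p"
  proof -
    obtain r B where "r > 0" and B: "\<And>y z. y \<in> mspace ?m \<Longrightarrow> z \<in> mspace ?m \<Longrightarrow>
        ?d a y < r \<Longrightarrow> ?d a z < r \<Longrightarrow> \<bar>\<psi>1 y - \<psi>1 z\<bar> \<le> B * ?d y z"
      using loc1 a unfolding locally_Lipschitz_iff by meson
    have "\<bar>\<psi>1 y - \<psi>1 z\<bar> \<le> \<bar>B\<bar> * ?d y z"
      if "y \<in> mspace ?m" "z \<in> mspace ?m" "?d a y < r" "?d a z < r" for y z
      using B[OF that] mult_right_mono[OF abs_ge_self mdist_nonneg, of B ?m y z] by linarith
    from slope_bounds(1)[OF this a a _ abs_ge_zero] show ?thesis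
      using \<open>r > 0\<close> a by (simp add: p_def)
  qed
  have env: "usc_env ?m (slope ?m \<psi>2) a = ereal \<alpha>" and \<alpha>: "0 \<le> \<alpha>"
    using usc_env_slope_finite[OF loc a] unfolding \<alpha>_def
    by (cases "usc_env ?m (slope ?m \<psi>2) a"; simp)+
  \<comment> \<open>\<theta> is the ratio of the localisation radius \<open>s\<close> to the
    distance \<open>t\<close> of the parabola's centre; the bound on \<open>p * \<theta>\<close>
    limits the variation of the parabola's slope.\<close>
  define \<theta> where "\<theta> = min 1 (\<epsilon> / (8 * (p + 1)))"
  have \<theta>: "0 < \<theta>" "\<theta> \<le> 1" "p * \<theta> \<le> \<epsilon> / 8"
  proof -
    show "0 < \<theta>" "\<theta> \<le> 1" using \<epsilon> p by (auto simp: \<theta>_def)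
    have "p * \<theta> \<le> (p + 1) * (\<epsilon> / (8 * (p + 1)))"
      using p \<epsilon> by (intro mult_mono) (auto simp: \<theta>_def)
    also have "\<dots> = \<epsilon> / 8" using p by (simp add: field_simps)
    finally show "p * \<theta> \<le> \<epsilon> / 8" .
  qed
  \<comment> \<open>The factor 1/16 makes \<open>\<epsilon>1 * (4 * t)\<close> at most
    \<open>\<epsilon> * s / 4\<close> when \<open>s = \<theta> * t\<close>. The bound by
    \<open>p / 2\<close> keeps the descent rate \<open>p - \<epsilon>1\<close> positive.\<close>
  define \<epsilon>1 where "\<epsilon>1 = (if p = 0 then \<epsilon> * \<theta> / 16 else min (\<epsilon> * \<theta> / 16) (p / 2))"
  have \<epsilon>1: "0 < \<epsilon>1" "\<epsilon>1 \<le> \<epsilon> * \<theta> / 16" "p > 0 \<Longrightarrow> \<epsilon>1 < p"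
    using p \<epsilon> \<theta> by (auto simp: \<epsilon>1_def)
  have "\<epsilon> * \<theta> \<le> \<epsilon> * 1" using \<epsilon> \<theta> by (intro mult_left_mono) auto
  then have \<epsilon>1': "\<epsilon>1 \<le> \<epsilon> / 16" using \<epsilon>1(2) by simp
  obtain r0 where r0: "r0 > 0" "\<And>y. y \<in> mspace ?m \<Longrightarrow> ?d a y < r0 \<Longrightarrow>
      v y - (\<psi>1 y + \<psi>2 y) \<le> v a - (\<psi>1 a + \<psi>2 a)"
    using locmax unfolding eventually_nhdsin_mdist[OF a] by blast
  obtain r1 where r1: "r1 > 0" "\<And>y. y \<in> mspace ?m \<Longrightarrow> ?d a y < r1 \<Longrightarrow> v y < v a + \<epsilon> / 4"
  proof -
    have "v a < v a + \<epsilon> / 4" using \<epsilon> by simp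
    from usc[unfolded usc_map_iff, rule_format, OF a this] show thesis using that by metis
  qed
  obtain r2 where r2: "r2 > 0" "\<And>y. y \<in> mspace ?m \<Longrightarrow> ?d a y < r2 \<Longrightarrow> slope ?m \<psi>1 y < p + \<epsilon>1"
  proof -
    have "usc_map (mtopology_of ?m) (slope ?m \<psi>1)"
      using C1 by (intro usc_map_of_continuous) (simp add: C1_minus_def)
    moreover have "slope ?m \<psi>1 a < p + \<epsilon>1" using \<epsilon>1 by (simp add: p_def)
    ultimately have "\<exists>r>0. \<forall>y\<in>mspace ?m. ?d a y < r \<longrightarrow> slope ?m \<psi>1 y < p + \<epsilon>1"
      using a unfolding usc_map_iff by simp
    then show thesis using that by metis
  qed
  obtain r3 where r3: "r3 > 0" "\<And>y. y \<in> mspace ?m \<Longrightarrow> ?d a y < r3 \<Longrightarrow> slope ?m \<psi>2 y < \<alpha> + \<epsilon>1"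
    using usc_env_lessD[OF a, of "slope ?m \<psi>2" "\<alpha> + \<epsilon>1"] env \<epsilon>1 by auto
  \<comment> \<open>The thirds come from \<open>Lipschitz_of_slope_less\<close>; the bound 1 lets an
    error proportional to \<open>t\<close> be treated as a multiple of \<epsilon> in the final
    estimate of \<open>w\<close>.\<close>
  define \<rho> where "\<rho> = min r0 (min r1 (min (r2 / 3) (min (r3 / 3) (min \<delta> (min (\<epsilon> / 4) 1)))))"
  have \<rho>: "0 < \<rho>" "\<rho> \<le> r0" "\<rho> \<le> r1" "\<rho> \<le> r2 / 3" "\<rho> \<le> r3 / 3" "\<rho> \<le> \<delta>" "\<rho> \<le> \<epsilon> / 4" "\<rho> \<le> 1"
    using r0(1) r1(1) r2(1) r3(1) \<delta> \<epsilon> unfolding \<rho>_def by linarith+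
  have Lip1: "\<bar>\<psi>1 y - \<psi>1 x\<bar> \<le> (p + \<epsilon>1) * ?d x y"
    if "x \<in> mspace ?m" "?d a x < \<rho>" "y \<in> mspace ?m" "?d a y < \<rho>" for x y
    by (rule Lipschitz_of_slope_less[OF geo loc1 a r2(2)]) (use that \<rho> in auto)
  have Lip2: "\<bar>\<psi>2 y - \<psi>2 x\<bar> \<le> (\<alpha> + \<epsilon>1) * ?d x y"
    if "x \<in> mspace ?m" "?d a x < \<rho>" "y \<in> mspace ?m" "?d a y < \<rho>" for x y
    by (rule Lipschitz_of_slope_less[OF geo loc a r3(2)]) (use that \<rho> in auto)
  have v_le: "v x \<le> v a + (\<psi>1 x - \<psi>1 a) + (\<alpha> + \<epsilon>1) * ?d a x" if "x \<in> mspace ?m" "?d a x < \<rho>" for x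
  proof -
    have "v x - (\<psi>1 x + \<psi>2 x) \<le> v a - (\<psi>1 a + \<psi>2 a)" using r0(2) that \<rho> by simp
    moreover have "\<psi>2 x - \<psi>2 a \<le> (\<alpha> + \<epsilon>1) * ?d a x" using Lip2[OF a _ that] \<rho>(1) a by simp
    ultimately show ?thesis by simp
  qed
  \<comment> \<open>The cone is wider than the Lipschitz bound \<open>\<alpha> + \<epsilon>1\<close>
    of the second component; the surplus pays for the errors of the first component and for the gap
    \<open>\<epsilon> * s / 4\<close>.\<close>
  let ?b = "\<alpha> + \<epsilon> / 2"
  have W: "v x \<le> v a + \<epsilon> / 4" if "x \<in> mspace ?m" "?d a x \<le> s" "s < \<rho>" for x s
    using r1(2)[OF that(1)] that \<rho> by simp
  show ?thesis
  proof (cases "p = 0")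
    \<comment> \<open>With zero slope the first component is itself absorbed by the cone, so the
      parabola is dropped: \<open>c = 0\<close>, with \<open>a\<close> as a dummy centre.\<close>
    case True
    define s where "s = \<rho> / 2"
    have s: "0 < s" "s < \<rho>" using \<rho> by (auto simp: s_def)
    have s_less: "s < \<delta>" and b: "0 \<le> ?b" and \<mu>: "0 < \<epsilon> * s / 4" and \<tau>: "0 < \<epsilon> / 8"
      using s \<rho> \<alpha> \<epsilon> by auto
    have "v x - 0 * (?d x a)\<^sup>2 - ?b * s + \<epsilon> * s / 4 \<le> v a - 0 * (?d a a)\<^sup>2"
      if x: "x \<in> mspace ?m" "?d a x = s" for x
    proof -
      have "\<psi>1 x - \<psi>1 a \<le> \<epsilon>1 * s" using Lip1[OF a _ x(1)] x s \<rho>(1) a True by simp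
      moreover have "v x \<le> v a + (\<psi>1 x - \<psi>1 a) + (\<alpha> + \<epsilon>1) * s" using v_le[OF x(1)] x s by simp
      moreover have "\<epsilon>1 * s \<le> \<epsilon> / 16 * s" using \<epsilon>1' s by (intro mult_right_mono) auto
      moreover have "0 \<le> \<epsilon> * s" using \<epsilon> s by simp
      ultimately show ?thesis by (simp add: distrib_right)
    qed
    from exists_approximate_solution[of H u v a as \<delta> a 0 ?b s "v a + \<epsilon> / 4" "\<epsilon> * s / 4" "\<epsilon> / 8" N,
      OF sub v a as pre a order_refl b s(1) s_less W[OF _ _ s(2)] this \<mu> \<tau>]
    obtain n z w q e where "N \<le> n" "z \<in> mspace (M (enat n))" "0 \<le> q" "dist z a \<le> s + \<epsilon> / 8"
      "w < v a + \<epsilon> / 4 + \<epsilon> / 8" "v a - \<epsilon> / 8 + (0 * e\<^sup>2 - 0 * (?d a a)\<^sup>2) \<le> w"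
      "\<bar>q - 2 * 0 * e\<bar> \<le> ?b + \<epsilon> / 8" "H (enat n) z w q \<le> \<epsilon> / 8"
      by blast
    then show ?thesis using \<epsilon> s \<rho> True
      by (intro exI[of _ n] conjI bexI[of _ z] exI[of _ w] exI[of _ q]) auto
  next
    case False
    then have ppos: "p > 0" using p by simp
    have "slope_minus ?m \<psi>1 a = p" using C1 a by (simp add: C1_minus_def p_def)
    then obtain y where y: "y \<in> mspace ?m" "y \<noteq> a" "?d a y < \<rho>"
      and desc: "\<psi>1 y < \<psi>1 a - (p - \<epsilon>1) * ?d a y"
      using less_slope_minusD[OF a, of "p - \<epsilon>1" \<psi>1 \<rho>] \<epsilon>1(1) \<epsilon>1(3)[OF ppos] \<rho>(1) by auto
    define t where "t = ?d a y"
    have t: "0 < t" "t < \<rho>" using y a by (auto simp: t_def less_le)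
    define s where "s = \<theta> * t"
    \<comment> \<open>This coefficient gives the parabola slope \<open>p\<close> at distance
      \<open>t\<close> from its centre, that is, at \<open>a\<close>.\<close>
    define c where "c = p / (2 * t)"
    \<comment> \<open>The tolerance is proportional to \<open>t\<close> because an error in the
      distance \<open>e\<close> enters the slope multiplied by \<open>2 * c\<close>, which is
      \<open>p / t\<close>.\<close>
    define \<tau> where "\<tau> = min (\<epsilon> / 8) (\<epsilon> * t / (8 * (p + 1)))"
    have "\<theta> * t \<le> 1 * t" using \<theta> t by (intro mult_right_mono) auto
    moreover have "0 < \<theta> * t" using \<theta> t by simp
    ultimately have s: "0 < s" "s \<le> t" "s < \<rho>" using t unfolding s_def by linarith+
    have s_less: "s < \<delta>" and b: "0 \<le> ?b" and \<mu>: "0 < \<epsilon> * s / 4"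
      using s \<rho> \<alpha> \<epsilon> by auto
    have c: "0 < c" using ppos t by (simp add: c_def)
    have \<tau>: "0 < \<tau>" "\<tau> \<le> \<epsilon> / 8" "p * \<tau> \<le> \<epsilon> / 8 * t"
    proof -
      show "0 < \<tau>" using \<epsilon> t p by (simp add: \<tau>_def)
      show "\<tau> \<le> \<epsilon> / 8" unfolding \<tau>_def by (rule min.cobounded1)
      have "p * \<tau> \<le> (p + 1) * (\<epsilon> * t / (8 * (p + 1)))"
        using p \<epsilon> t by (intro mult_mono) (auto simp: \<tau>_def)
      also have "\<dots> = \<epsilon> / 8 * t" using p by (simp add: field_simps)
      finally show "p * \<tau> \<le> \<epsilon> / 8 * t" .
    qed
    have ct: "c * t\<^sup>2 = p * t / 2" using t by (simp add: c_def power2_eq_square)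
    have tangent: "p * X - p * t / 2 \<le> c * X\<^sup>2" for X
      unfolding c_def by (rule mult_power2_ge_tangent[OF p t(1)])
    \<comment> \<open>With X the distance from x to y, the growth bound from y and the descent from
      a to y give psi_1(x) - psi_1(a) \<le> p (X - t) + \<epsilon>1 (X + t). Convexity bounds p (X -
      t) by the increment of the parabola, and X \<le> t + s bounds the remaining error by a quarter
      of \<open>\<epsilon> * s\<close>.\<close>
    have "v x - c * (?d x y)\<^sup>2 - ?b * s + \<epsilon> * s / 4 \<le> v a - c * (?d a y)\<^sup>2"
      if x: "x \<in> mspace ?m" "?d a x = s" for x
    proof -
      let ?X = "?d x y"
      have "v x \<le> v a + (\<psi>1 x - \<psi>1 a) + (\<alpha> + \<epsilon>1) * s" using v_le[OF x(1)] x s by simp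
      moreover have "\<psi>1 x - \<psi>1 y \<le> (p + \<epsilon>1) * ?X"
        using Lip1[OF y(1,3) x(1)] x s by (simp add: mdist_commute)
      moreover have "\<epsilon>1 * (?X + t + s) \<le> \<epsilon> * s / 4"
      proof -
        have "?X \<le> t + s"
          using mdist_triangle[of x ?m a y] x y a by (simp add: t_def mdist_commute)
        then have "\<epsilon>1 * (?X + t + s) \<le> (\<epsilon> * \<theta> / 16) * (4 * t)"
          using \<epsilon>1 s t \<epsilon> \<theta> by (intro mult_mono) auto
        then show ?thesis by (simp add: s_def)
      qed
      ultimately show ?thesis
        using desc tangent[of ?X] ct unfolding t_def[symmetric]
        by (simp add: distrib_right distrib_left left_diff_distrib)
    qed
    from exists_approximate_solution[of H u v a as \<delta> y c ?b s "v a + \<epsilon> / 4" "\<epsilon> * s / 4" \<tau> N,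
      OF sub v a as pre y(1) less_imp_le[OF c] b s(1) s_less W[OF _ _ s(3)] this \<mu> \<tau>(1)]
    obtain n z w q e where n: "N \<le> n" "z \<in> mspace (M (enat n))" and q: "0 \<le> q"
      and z: "dist z a \<le> s + \<tau>" and w: "w < v a + \<epsilon> / 4 + \<tau>" and e: "\<bar>e - t\<bar> \<le> s + \<tau>"
      and w': "v a - \<tau> + (c * e\<^sup>2 - c * t\<^sup>2) \<le> w"
      and qe: "\<bar>q - 2 * c * e\<bar> \<le> ?b + \<tau>" and Hq: "H (enat n) z w q \<le> \<tau>"
      unfolding t_def by blast
    \<comment> \<open>Half of the bound comes from \<open>s = \<theta> * t\<close>, half from the
      choice of \<tau>; dividing by \<open>t\<close> gives the deviation of the slope
      \<open>2 * c * e\<close> from \<open>p\<close>.\<close>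
    have pe: "p * \<bar>e - t\<bar> \<le> \<epsilon> / 4 * t"
    proof -
      have "p * \<bar>e - t\<bar> \<le> p * (s + \<tau>)" using e p by (intro mult_left_mono) auto
      moreover have "p * s \<le> \<epsilon> / 8 * t"
        using mult_right_mono[OF \<theta>(3), of t] t by (simp add: s_def mult_ac)
      ultimately show ?thesis using \<tau>(3) unfolding distrib_left by linarith
    qed
    have "2 * c * e - p = p * (e - t) / t" using t by (simp add: c_def field_simps)
    then have "\<bar>2 * c * e - p\<bar> = p * \<bar>e - t\<bar> / t" using t p by (simp add: abs_mult)
    also have "\<dots> \<le> \<epsilon> / 4" using pe t by (simp add: divide_le_eq)
    finally have "\<bar>2 * c * e - p\<bar> \<le> \<epsilon> / 4" .
    then have "\<bar>q - p\<bar> \<le> \<alpha> + \<epsilon>" using qe \<tau>(2) \<epsilon> by linarith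
    \<comment> \<open>The parabola at the new point can fall below its value at distance
      \<open>t\<close> only by a multiple of \<open>\<epsilon> * t\<close>, again because it lies
      above its tangent.\<close>
    moreover have "v a - \<epsilon> < w"
    proof -
      have "- (p * \<bar>e - t\<bar>) \<le> p * (e - t)"
        using mult_left_mono[OF _ p, of "- \<bar>e - t\<bar>" "e - t"] by simp
      also have "\<dots> \<le> c * e\<^sup>2 - c * t\<^sup>2" using tangent[of e] ct by (simp add: right_diff_distrib)
      finally have "- (\<epsilon> / 4 * t) \<le> c * e\<^sup>2 - c * t\<^sup>2" using pe by simp
      moreover have "\<epsilon> / 4 * t \<le> \<epsilon> / 4 * 1" using t \<rho>(8) \<epsilon> by (intro mult_left_mono) auto
      ultimately show ?thesis using w' \<tau>(2) \<epsilon> by linarith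
    qed
    ultimately show ?thesis using n q z w Hq \<tau>(2) \<epsilon> s \<rho>
      by (intro exI[of _ n] conjI bexI[of _ z] exI[of _ w] exI[of _ q]) auto
  qed
qed

section \<open>Passage to the limit in the Hamiltonians\<close>

text \<open>Approximate solutions with errors 1/(k+1) are taken at increasing indices. Their momenta
  are bounded, and a limit momentum satisfies the limit inequality at distance at most \<alpha> from
  \<open>p\<close>; this one momentum bounds the infimum in \<open>Ham_inf\<close>.\<close>

theorem viscosity_subsolution_upper_semilimit:
  fixes u :: "nat \<Rightarrow> 'a \<Rightarrow> real" and H :: "enat \<Rightarrow> 'a \<Rightarrow> real \<Rightarrow> real \<Rightarrow> real"
  assumes ham_conv: "\<And>x xs us r ps p. x \<in> mspace (M \<infinity>) \<Longrightarrow> xs \<in> seqs x \<Longrightarrow> us \<longlonglongrightarrow> r \<Longrightarrow>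
      (\<And>n. 0 \<le> ps n) \<Longrightarrow> 0 \<le> p \<Longrightarrow> ps \<longlonglongrightarrow> p \<Longrightarrow>
      (\<lambda>n. H (enat n) (xs n) (us n) (ps n)) \<longlonglongrightarrow> H \<infinity> x r p"
    and pre: "\<And>a as. a \<in> mspace (M \<infinity>) \<Longrightarrow> as \<in> seqs a \<Longrightarrow> \<exists>\<delta>>0. precompact_at a as \<delta>"
    and sub: "\<And>n. viscosity_subsolution (M (enat n)) (H (enat n)) (u n)"
    and v: "\<And>x. x \<in> mspace (M \<infinity>) \<Longrightarrow> upper_semilimit (\<lambda>n. mspace (M n)) u x = ereal (v x)"
    and usc: "usc_map (mtopology_of (M \<infinity>)) v"
  shows "viscosity_subsolution (M \<infinity>) (H \<infinity>) v"
proof -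
  have env: "usc_env (M \<infinity>) v x = ereal (v x)" if "x \<in> mspace (M \<infinity>)" for x
    by (rule usc_env_eq_of_usc[OF usc that])
  have "Ham_inf (H \<infinity>) (real_of_ereal (usc_env (M \<infinity>) (slope (M \<infinity>) \<psi>2) a)) a (v a) (slope (M \<infinity>) \<psi>1 a) \<le> 0"
    if a: "a \<in> mspace (M \<infinity>)" and C1: "C1_minus (M \<infinity>) \<psi>1" and loc: "locally_Lipschitz (M \<infinity>) \<psi>2"
      and ev: "\<forall>\<^sub>F y in nhdsin (mtopology_of (M \<infinity>)) a. real_of_ereal (usc_env (M \<infinity>) v y) - (\<psi>1 y + \<psi>2 y)
        \<le> real_of_ereal (usc_env (M \<infinity>) v a) - (\<psi>1 a + \<psi>2 a)" for \<psi>1 \<psi>2 a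
  proof -
    define p where "p = slope (M \<infinity>) \<psi>1 a"
    define \<alpha> where "\<alpha> = real_of_ereal (usc_env (M \<infinity>) (slope (M \<infinity>) \<psi>2) a)"
    define \<epsilon> where "\<epsilon> k = inverse (real (Suc k))" for k
    have \<epsilon>: "\<epsilon> k > 0" "\<epsilon> k \<le> 1" "\<epsilon> \<longlonglongrightarrow> 0" for k
      unfolding \<epsilon>_def using LIMSEQ_inverse_real_of_nat by (auto simp: field_simps)
    have locmax: "\<forall>\<^sub>F y in nhdsin (mtopology_of (M \<infinity>)) a. v y - (\<psi>1 y + \<psi>2 y) \<le> v a - (\<psi>1 a + \<psi>2 a)"
      using ev env unfolding eventually_nhdsin_mdist[OF a] by (simp add: a)
    obtain as where as: "as \<in> seqs a"
      using v[OF a] unfolding upper_semilimit_def by (cases "seqs a = {}") (auto simp: bot_ereal_def)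
    obtain \<delta> where \<delta>: "\<delta> > 0" "precompact_at a as \<delta>" using pre[OF a as] by blast
    define P where "P k n \<longleftrightarrow> (\<exists>z\<in>mspace (M (enat n)). \<exists>w q. 0 \<le> q \<and> dist z a < \<epsilon> k \<and>
      \<bar>w - v a\<bar> < \<epsilon> k \<and> \<bar>q - p\<bar> \<le> \<alpha> + \<epsilon> k \<and> H (enat n) z w q \<le> \<epsilon> k)" for k n
    have "\<exists>n\<ge>N. P k n" for k N
      unfolding P_def p_def \<alpha>_def
      by (rule approximate_solution_near_max[OF sub v usc a as \<delta>(2,1) C1 loc
          locmax \<epsilon>(1)])
    then obtain r where r: "strict_mono r" and rk: "\<And>k. P k (r k)"
      by (rule strict_mono_subseq_exists[of P]) (use that in blast)
    have "\<exists>t. fst t \<in> mspace (M (enat (r k))) \<and> 0 \<le> snd (snd t) \<and> dist (fst t) a < \<epsilon> k \<and>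
        \<bar>fst (snd t) - v a\<bar> < \<epsilon> k \<and> \<bar>snd (snd t) - p\<bar> \<le> \<alpha> + \<epsilon> k \<and>
        H (enat (r k)) (fst t) (fst (snd t)) (snd (snd t)) \<le> \<epsilon> k" for k
    proof -
      obtain z w q where "z \<in> mspace (M (enat (r k)))" "0 \<le> q" "dist z a < \<epsilon> k" "\<bar>w - v a\<bar> < \<epsilon> k"
          "\<bar>q - p\<bar> \<le> \<alpha> + \<epsilon> k" "H (enat (r k)) z w q \<le> \<epsilon> k"
        using rk[of k] unfolding P_def by blast
      then show ?thesis by (intro exI[of _ "(z, w, q)"]) simp
    qed
    then have "\<forall>k. \<exists>t. fst t \<in> mspace (M (enat (r k))) \<and> 0 \<le> snd (snd t) \<and> dist (fst t) a < \<epsilon> k \<and>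
        \<bar>fst (snd t) - v a\<bar> < \<epsilon> k \<and> \<bar>snd (snd t) - p\<bar> \<le> \<alpha> + \<epsilon> k \<and>
        H (enat (r k)) (fst t) (fst (snd t)) (snd (snd t)) \<le> \<epsilon> k" by (rule allI)
    from choice[OF this] obtain t where t: "\<And>k. fst (t k) \<in> mspace (M (enat (r k))) \<and>
        0 \<le> snd (snd (t k)) \<and> dist (fst (t k)) a < \<epsilon> k \<and>
        \<bar>fst (snd (t k)) - v a\<bar> < \<epsilon> k \<and> \<bar>snd (snd (t k)) - p\<bar> \<le> \<alpha> + \<epsilon> k \<and>
        H (enat (r k)) (fst (t k)) (fst (snd (t k))) (snd (snd (t k))) \<le> \<epsilon> k"
      by blast
    define z w q where "z k = fst (t k)" and "w k = fst (snd (t k))" and "q k = snd (snd (t k))" for k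
    have z: "z k \<in> mspace (M (enat (r k)))" "dist (z k) a \<le> \<epsilon> k"
      and w: "\<bar>w k - v a\<bar> \<le> \<epsilon> k" and q: "0 \<le> q k" "\<bar>q k - p\<bar> \<le> \<alpha> + \<epsilon> k"
      and Hk: "H (enat (r k)) (z k) (w k) (q k) \<le> \<epsilon> k" for k
      using t[of k] by (auto simp: z_def w_def q_def)
    \<comment> \<open>Points and values converge by construction; only the momenta require the
      extraction of a further subsequence.\<close>
    have "q k \<in> {0..p + \<alpha> + 1}" for k using q[of k] \<epsilon>(2)[of k] by auto
    then obtain q' \<sigma> where \<sigma>: "strict_mono \<sigma>" and q': "(q \<circ> \<sigma>) \<longlonglongrightarrow> q'"
      using compact_Icc[of 0 "p + \<alpha> + 1"] unfolding compact_def by metis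
    have \<epsilon>\<sigma>: "(\<lambda>k. \<epsilon> (\<sigma> k)) \<longlonglongrightarrow> 0"
      using LIMSEQ_subseq_LIMSEQ[OF \<epsilon>(3) \<sigma>] by (simp add: o_def)
    have "0 \<le> q'" using q(1) by (intro LIMSEQ_le_const[OF q']) auto
    have q'p: "\<bar>q' - p\<bar> \<le> \<alpha>"
    proof -
      have "(\<lambda>k. \<bar>(q \<circ> \<sigma>) k - p\<bar>) \<longlonglongrightarrow> \<bar>q' - p\<bar>" by (intro tendsto_intros q')
      moreover have "(\<lambda>k. \<alpha> + \<epsilon> (\<sigma> k)) \<longlonglongrightarrow> \<alpha> + 0" by (intro tendsto_intros \<epsilon>\<sigma>)
      ultimately have "\<bar>q' - p\<bar> \<le> \<alpha> + 0" by (rule LIMSEQ_le) (use q(2) in auto)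
      then show ?thesis by simp
    qed
    define R where "R = r \<circ> \<sigma>"
    have R: "strict_mono R" unfolding R_def by (rule strict_mono_o[OF r \<sigma>])
    have R_apply: "R k = r (\<sigma> k)" for k by (simp add: R_def)
    have inv_R: "inv R (R k) = k" for k by (rule inv_f_f[OF strict_mono_imp_inj_on[OF R]])
    \<comment> \<open>Outside the range of \<open>R\<close> the sequences take harmless values with
      the same limits: the given sequence \<open>as\<close>, the constant \<open>v a\<close> and the
      constant \<open>q'\<close>.\<close>
    define xs where "xs n = (if n \<in> range R then (z \<circ> \<sigma>) (inv R n) else as n)" for n
    define us where "us n = (if n \<in> range R then (w \<circ> \<sigma>) (inv R n) else v a)" for n
    define ps where "ps n = (if n \<in> range R then (q \<circ> \<sigma>) (inv R n) else q')" for n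
    have at_R: "xs (R k) = z (\<sigma> k)" "us (R k) = w (\<sigma> k)" "ps (R k) = q (\<sigma> k)" for k
      by (simp_all add: xs_def us_def ps_def inv_R)
    have "(\<lambda>k. dist ((z \<circ> \<sigma>) k) a) \<longlonglongrightarrow> 0"
      using z(2) by (intro Lim_null_comparison[OF _ \<epsilon>\<sigma>]) auto
    then have "(z \<circ> \<sigma>) \<longlonglongrightarrow> a" by (rule tendsto_dist_iff[THEN iffD2])
    then have "xs \<longlonglongrightarrow> a"
      unfolding xs_def using as by (intro tendsto_fill_subseq[OF R]) (simp_all add: approx_seqs_def o_def)
    moreover have "xs n \<in> mspace (M (enat n))" for n
    proof (cases "n \<in> range R")
      case True
      then obtain k where "n = R k" by blast
      then show ?thesis using z(1)[of "\<sigma> k"] by (simp add: at_R) (simp add: R_apply)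
    qed (use seqs_in[OF as] in \<open>simp add: xs_def\<close>)
    ultimately have xs: "xs \<in> seqs a" by (simp add: approx_seqs_def)
    have "(\<lambda>k. (w \<circ> \<sigma>) k - v a) \<longlonglongrightarrow> 0"
      using w by (intro Lim_null_comparison[OF _ \<epsilon>\<sigma>]) auto
    then have "(w \<circ> \<sigma>) \<longlonglongrightarrow> v a" by (rule LIM_zero_cancel)
    then have us: "us \<longlonglongrightarrow> v a" unfolding us_def by (rule tendsto_fill_subseq[OF R]) simp
    have ps: "ps \<longlonglongrightarrow> q'" unfolding ps_def by (rule tendsto_fill_subseq[OF R q']) simp
    have "0 \<le> ps n" for n using q(1) \<open>0 \<le> q'\<close> by (simp add: ps_def)
    from ham_conv[OF a xs us this \<open>0 \<le> q'\<close> ps]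
    have "(\<lambda>k. H (enat (R k)) (xs (R k)) (us (R k)) (ps (R k))) \<longlonglongrightarrow> H \<infinity> a (v a) q'"
      using LIMSEQ_subseq_LIMSEQ[OF _ R] by (fastforce simp: o_def)
    then have "H \<infinity> a (v a) q' \<le> 0"
    proof (rule LIMSEQ_le[OF _ \<epsilon>\<sigma>])
      have "H (enat (R k)) (xs (R k)) (us (R k)) (ps (R k)) \<le> \<epsilon> (\<sigma> k)" for k
        using Hk[of "\<sigma> k"] unfolding at_R by (simp add: R_apply)
      then show "\<exists>N. \<forall>k\<ge>N. H (enat (R k)) (xs (R k)) (us (R k)) (ps (R k)) \<le> \<epsilon> (\<sigma> k)" by blast
    qed
    then show ?thesis
      unfolding Ham_inf_def p_def[symmetric] \<alpha>_def[symmetric]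
      using \<open>0 \<le> q'\<close> q'p by (intro INF_lower2[of q']) auto
  qed
  then show ?thesis unfolding viscosity_subsolution_def using env by simp
qed

end

section \<open>Application to intrinsic metrics, and the supersolution case by duality\<close>

theorem theorem8p3:
  fixes X :: "enat \<Rightarrow> 'a::metric_space set"
    and H :: "enat \<Rightarrow> 'a \<Rightarrow> real \<Rightarrow> real \<Rightarrow> real"
  assumes proper: "\<forall>(x::'a) r. compact (cball x r)"
    and nonempty: "\<forall>n. X n \<noteq> {}"
    and geodesic: "\<forall>n. complete_geodesic_space (X n) (intrinsic_dist (X n))"
    and hausdorff_conv:
      "(\<lambda>n. max (SUP x\<in>X (enat n). ereal (infdist x (X \<infinity>)))
                (SUP x\<in>X \<infinity>. ereal (infdist x (X (enat n))))) \<longlonglongrightarrow> 0"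
    and dist_conv:
      "\<forall>a\<in>X \<infinity>. \<forall>b\<in>X \<infinity>. \<forall>as\<in>approx_seqs X a. \<forall>bs\<in>approx_seqs X b.
         (\<lambda>n. intrinsic_dist (X (enat n)) (as n) (bs n)) \<longlonglongrightarrow> intrinsic_dist (X \<infinity>) a b"
    and ham_conv:
      "\<forall>x\<in>X \<infinity>. \<forall>xs\<in>approx_seqs X x. \<forall>(us::nat \<Rightarrow> real) u (ps::nat \<Rightarrow> real) p.
         us \<longlonglongrightarrow> u \<longrightarrow> (\<forall>n. 0 \<le> ps n) \<longrightarrow> 0 \<le> p \<longrightarrow> ps \<longlonglongrightarrow> p \<longrightarrow>
         (\<lambda>n. H (enat n) (xs n) (us n) (ps n)) \<longlonglongrightarrow> H \<infinity> x u p"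
  shows
    "((\<forall>a\<in>X \<infinity>. \<forall>as\<in>approx_seqs X a. \<forall>(\<phi>::nat \<Rightarrow> 'a \<Rightarrow> real) \<phi>_inf.
         (\<forall>n. usc_map (mtopology_of (intrinsic_metric (X (enat n)))) (\<phi> n)) \<longrightarrow>
         usc_map (mtopology_of (intrinsic_metric (X \<infinity>))) \<phi>_inf \<longrightarrow>
         (\<forall>x\<in>X \<infinity>. \<forall>xs\<in>approx_seqs X x.
            limsup (\<lambda>n. ereal (\<phi> n (xs n))) \<le> ereal (\<phi>_inf x)) \<longrightarrow>
         (\<exists>\<delta>>0. \<forall>r. 0 < r \<longrightarrow> r < \<delta> \<longrightarrow>
            limsup (\<lambda>n. SUP y\<in>mcball_of (intrinsic_metric (X (enat n))) (as n) r. ereal (\<phi> n y))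
              \<le> (SUP y\<in>mcball_of (intrinsic_metric (X \<infinity>)) a r. ereal (\<phi>_inf y))))
      \<longrightarrow>
      (\<forall>u::nat \<Rightarrow> 'a \<Rightarrow> real.
         (\<forall>n. viscosity_subsolution (intrinsic_metric (X (enat n))) (H (enat n)) (u n)) \<longrightarrow>
         (\<forall>x\<in>X \<infinity>. \<bar>upper_semilimit X u x\<bar> \<noteq> \<infinity>) \<longrightarrow>
         usc_map (mtopology_of (intrinsic_metric (X \<infinity>)))
           (\<lambda>x. real_of_ereal (upper_semilimit X u x)) \<longrightarrow>
         viscosity_subsolution (intrinsic_metric (X \<infinity>)) (H \<infinity>)
           (\<lambda>x. real_of_ereal (upper_semilimit X u x))))
     \<and>
     ((\<forall>a\<in>X \<infinity>. \<forall>as\<in>approx_seqs X a. \<forall>(\<phi>::nat \<Rightarrow> 'a \<Rightarrow> real) \<phi>_inf.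
         (\<forall>n. lsc_map (mtopology_of (intrinsic_metric (X (enat n)))) (\<phi> n)) \<longrightarrow>
         lsc_map (mtopology_of (intrinsic_metric (X \<infinity>))) \<phi>_inf \<longrightarrow>
         (\<forall>x\<in>X \<infinity>. \<forall>xs\<in>approx_seqs X x.
            liminf (\<lambda>n. ereal (\<phi> n (xs n))) \<ge> ereal (\<phi>_inf x)) \<longrightarrow>
         (\<exists>\<delta>>0. \<forall>r. 0 < r \<longrightarrow> r < \<delta> \<longrightarrow>
            liminf (\<lambda>n. INF y\<in>mcball_of (intrinsic_metric (X (enat n))) (as n) r. ereal (\<phi> n y))
              \<ge> (INF y\<in>mcball_of (intrinsic_metric (X \<infinity>)) a r. ereal (\<phi>_inf y))))
      \<longrightarrow>
      (\<forall>u::nat \<Rightarrow> 'a \<Rightarrow> real.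
         (\<forall>n. viscosity_supersolution (intrinsic_metric (X (enat n))) (H (enat n)) (u n)) \<longrightarrow>
         (\<forall>x\<in>X \<infinity>. \<bar>lower_semilimit X u x\<bar> \<noteq> \<infinity>) \<longrightarrow>
         lsc_map (mtopology_of (intrinsic_metric (X \<infinity>)))
           (\<lambda>x. real_of_ereal (lower_semilimit X u x)) \<longrightarrow>
         viscosity_supersolution (intrinsic_metric (X \<infinity>)) (H \<infinity>)
           (\<lambda>x. real_of_ereal (lower_semilimit X u x))))"
proof -
  have ms: "Metric_space (X n) (intrinsic_dist (X n))" for n
    using geodesic by (simp add: complete_geodesic_space_def)
  have space [simp]: "mspace (intrinsic_metric (X n)) = X n"
    and mdist [simp]: "mdist (intrinsic_metric (X n)) = intrinsic_dist (X n)" for n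
    unfolding intrinsic_metric_def
    by (rule Metric_space.mspace_metric[OF ms], rule Metric_space.mdist_metric[OF ms])
  interpret converging_metrics "\<lambda>n. intrinsic_metric (X n)"
    by standard (use geodesic dist_le_intrinsic_dist[OF ms] dist_conv in auto)
  have seqs: "seqs = approx_seqs X" by simp
  \<comment> \<open>The Hamiltonian is left arbitrary here, since the statement is used both for
    \<open>H\<close> and for its reflection in part (b).\<close>
  have sub: "viscosity_subsolution (intrinsic_metric (X \<infinity>)) (G \<infinity>)
      (\<lambda>x. real_of_ereal (upper_semilimit X u x))"
    if hyp: "\<forall>a\<in>X \<infinity>. \<forall>as\<in>approx_seqs X a. \<forall>(\<phi>::nat \<Rightarrow> 'a \<Rightarrow> real) \<phi>_inf.
         (\<forall>n. usc_map (mtopology_of (intrinsic_metric (X (enat n)))) (\<phi> n)) \<longrightarrow>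
         usc_map (mtopology_of (intrinsic_metric (X \<infinity>))) \<phi>_inf \<longrightarrow>
         (\<forall>x\<in>X \<infinity>. \<forall>xs\<in>approx_seqs X x.
            limsup (\<lambda>n. ereal (\<phi> n (xs n))) \<le> ereal (\<phi>_inf x)) \<longrightarrow>
         (\<exists>\<delta>>0. \<forall>r. 0 < r \<longrightarrow> r < \<delta> \<longrightarrow>
            limsup (\<lambda>n. SUP y\<in>mcball_of (intrinsic_metric (X (enat n))) (as n) r. ereal (\<phi> n y))
              \<le> (SUP y\<in>mcball_of (intrinsic_metric (X \<infinity>)) a r. ereal (\<phi>_inf y)))"
      and conv: "\<forall>x\<in>X \<infinity>. \<forall>xs\<in>approx_seqs X x. \<forall>(us::nat \<Rightarrow> real) u (ps::nat \<Rightarrow> real) p.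
         us \<longlonglongrightarrow> u \<longrightarrow> (\<forall>n. 0 \<le> ps n) \<longrightarrow> 0 \<le> p \<longrightarrow> ps \<longlonglongrightarrow> p \<longrightarrow>
         (\<lambda>n. G (enat n) (xs n) (us n) (ps n)) \<longlonglongrightarrow> G \<infinity> x u p"
      and sub: "\<forall>n. viscosity_subsolution (intrinsic_metric (X (enat n))) (G (enat n)) (u n)"
      and fin: "\<forall>x\<in>X \<infinity>. \<bar>upper_semilimit X u x\<bar> \<noteq> \<infinity>"
      and usc: "usc_map (mtopology_of (intrinsic_metric (X \<infinity>)))
           (\<lambda>x. real_of_ereal (upper_semilimit X u x))"
    for G :: "enat \<Rightarrow> 'a \<Rightarrow> real \<Rightarrow> real \<Rightarrow> real" and u
  proof (rule viscosity_subsolution_upper_semilimit[OF _ _ _ _ usc])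
    show "upper_semilimit (\<lambda>n. mspace (intrinsic_metric (X n))) u x
        = ereal (real_of_ereal (upper_semilimit X u x))" if "x \<in> mspace (intrinsic_metric (X \<infinity>))" for x
      using fin that by (simp add: ereal_real')
    show "\<exists>\<delta>>0. precompact_at a as \<delta>"
      if "a \<in> mspace (intrinsic_metric (X \<infinity>))" "as \<in> seqs a" for a as
    proof (rule precompact_at_exists[OF that])
      have a: "a \<in> X \<infinity>" and as: "as \<in> approx_seqs X a" using that by simp_all
      fix \<phi> :: "nat \<Rightarrow> 'a \<Rightarrow> real" and \<phi>_inf
      assume "\<And>n. usc_map (mtopology_of (intrinsic_metric (X (enat n)))) (\<phi> n)"
        "usc_map (mtopology_of (intrinsic_metric (X \<infinity>))) \<phi>_inf"
        "\<And>x xs. x \<in> mspace (intrinsic_metric (X \<infinity>)) \<Longrightarrow> xs \<in> seqs x \<Longrightarrow>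
          limsup (\<lambda>n. ereal (\<phi> n (xs n))) \<le> ereal (\<phi>_inf x)"
      then show "\<exists>\<delta>>0. \<forall>r. 0 < r \<longrightarrow> r < \<delta> \<longrightarrow>
          limsup (\<lambda>n. SUP y\<in>mcball_of (intrinsic_metric (X (enat n))) (as n) r. ereal (\<phi> n y))
            \<le> (SUP y\<in>mcball_of (intrinsic_metric (X \<infinity>)) a r. ereal (\<phi>_inf y))"
        unfolding space
        by (intro hyp[rule_format, OF a as, of \<phi> \<phi>_inf]) assumption+
    qed
  qed (use conv sub in simp_all)
  show ?thesis
  proof (intro conjI impI allI)
    fix u :: "nat \<Rightarrow> 'a \<Rightarrow> real"
    assume hyp: "\<forall>a\<in>X \<infinity>. \<forall>as\<in>approx_seqs X a. \<forall>(\<phi>::nat \<Rightarrow> 'a \<Rightarrow> real) \<phi>_inf.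
         (\<forall>n. usc_map (mtopology_of (intrinsic_metric (X (enat n)))) (\<phi> n)) \<longrightarrow>
         usc_map (mtopology_of (intrinsic_metric (X \<infinity>))) \<phi>_inf \<longrightarrow>
         (\<forall>x\<in>X \<infinity>. \<forall>xs\<in>approx_seqs X x.
            limsup (\<lambda>n. ereal (\<phi> n (xs n))) \<le> ereal (\<phi>_inf x)) \<longrightarrow>
         (\<exists>\<delta>>0. \<forall>r. 0 < r \<longrightarrow> r < \<delta> \<longrightarrow>
            limsup (\<lambda>n. SUP y\<in>mcball_of (intrinsic_metric (X (enat n))) (as n) r. ereal (\<phi> n y))
              \<le> (SUP y\<in>mcball_of (intrinsic_metric (X \<infinity>)) a r. ereal (\<phi>_inf y)))"
      and u: "\<forall>n. viscosity_subsolution (intrinsic_metric (X (enat n))) (H (enat n)) (u n)"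
        "\<forall>x\<in>X \<infinity>. \<bar>upper_semilimit X u x\<bar> \<noteq> \<infinity>"
        "usc_map (mtopology_of (intrinsic_metric (X \<infinity>)))
           (\<lambda>x. real_of_ereal (upper_semilimit X u x))"
    show "viscosity_subsolution (intrinsic_metric (X \<infinity>)) (H \<infinity>)
           (\<lambda>x. real_of_ereal (upper_semilimit X u x))"
      by (rule sub[OF hyp ham_conv u])
  next
    fix u :: "nat \<Rightarrow> 'a \<Rightarrow> real"
    assume hyp: "\<forall>a\<in>X \<infinity>. \<forall>as\<in>approx_seqs X a. \<forall>(\<phi>::nat \<Rightarrow> 'a \<Rightarrow> real) \<phi>_inf.
         (\<forall>n. lsc_map (mtopology_of (intrinsic_metric (X (enat n)))) (\<phi> n)) \<longrightarrow>
         lsc_map (mtopology_of (intrinsic_metric (X \<infinity>))) \<phi>_inf \<longrightarrow>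
         (\<forall>x\<in>X \<infinity>. \<forall>xs\<in>approx_seqs X x.
            liminf (\<lambda>n. ereal (\<phi> n (xs n))) \<ge> ereal (\<phi>_inf x)) \<longrightarrow>
         (\<exists>\<delta>>0. \<forall>r. 0 < r \<longrightarrow> r < \<delta> \<longrightarrow>
            liminf (\<lambda>n. INF y\<in>mcball_of (intrinsic_metric (X (enat n))) (as n) r. ereal (\<phi> n y))
              \<ge> (INF y\<in>mcball_of (intrinsic_metric (X \<infinity>)) a r. ereal (\<phi>_inf y)))"
      and u: "\<forall>n. viscosity_supersolution (intrinsic_metric (X (enat n))) (H (enat n)) (u n)"
        "\<forall>x\<in>X \<infinity>. \<bar>lower_semilimit X u x\<bar> \<noteq> \<infinity>"
        "lsc_map (mtopology_of (intrinsic_metric (X \<infinity>)))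
           (\<lambda>x. real_of_ereal (lower_semilimit X u x))"
    let ?G = "\<lambda>n x r p. - H n x (- r) p"
    have "viscosity_subsolution (intrinsic_metric (X \<infinity>)) (?G \<infinity>)
        (\<lambda>x. real_of_ereal (upper_semilimit X (\<lambda>n x. - u n x) x))"
    proof (rule sub)
      show "\<forall>x\<in>X \<infinity>. \<forall>xs\<in>approx_seqs X x. \<forall>(us::nat \<Rightarrow> real) u (ps::nat \<Rightarrow> real) p.
         us \<longlonglongrightarrow> u \<longrightarrow> (\<forall>n. 0 \<le> ps n) \<longrightarrow> 0 \<le> p \<longrightarrow> ps \<longlonglongrightarrow> p \<longrightarrow>
         (\<lambda>n. ?G (enat n) (xs n) (us n) (ps n)) \<longlonglongrightarrow> ?G \<infinity> x u p"
        by (intro ballI allI impI tendsto_minus ham_conv[rule_format]) auto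
      show "\<forall>n. viscosity_subsolution (intrinsic_metric (X (enat n))) (?G (enat n)) (\<lambda>x. - u n x)"
        using u(1) by (simp add: viscosity_subsolution_uminus)
      show "\<forall>x\<in>X \<infinity>. \<bar>upper_semilimit X (\<lambda>n x. - u n x) x\<bar> \<noteq> \<infinity>"
        using u(2) by (simp add: upper_semilimit_uminus)
      show "usc_map (mtopology_of (intrinsic_metric (X \<infinity>)))
          (\<lambda>x. real_of_ereal (upper_semilimit X (\<lambda>n x. - u n x) x))"
        using u(3) by (simp add: upper_semilimit_uminus usc_map_uminus)
      show "\<forall>a\<in>X \<infinity>. \<forall>as\<in>approx_seqs X a. \<forall>(\<phi>::nat \<Rightarrow> 'a \<Rightarrow> real) \<phi>_inf.
         (\<forall>n. usc_map (mtopology_of (intrinsic_metric (X (enat n)))) (\<phi> n)) \<longrightarrow>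
         usc_map (mtopology_of (intrinsic_metric (X \<infinity>))) \<phi>_inf \<longrightarrow>
         (\<forall>x\<in>X \<infinity>. \<forall>xs\<in>approx_seqs X x.
            limsup (\<lambda>n. ereal (\<phi> n (xs n))) \<le> ereal (\<phi>_inf x)) \<longrightarrow>
         (\<exists>\<delta>>0. \<forall>r. 0 < r \<longrightarrow> r < \<delta> \<longrightarrow>
            limsup (\<lambda>n. SUP y\<in>mcball_of (intrinsic_metric (X (enat n))) (as n) r. ereal (\<phi> n y))
              \<le> (SUP y\<in>mcball_of (intrinsic_metric (X \<infinity>)) a r. ereal (\<phi>_inf y)))"
      \<comment> \<open>The hypothesis on infima, applied to the negated functions, becomes the
        hypothesis on suprema; the radius \<delta> is the same.\<close>
      proof (intro ballI allI impI)
        fix a as and \<phi> :: "nat \<Rightarrow> 'a \<Rightarrow> real" and \<phi>_inf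
        assume a: "a \<in> X \<infinity>" and as: "as \<in> approx_seqs X a"
          and usc: "\<forall>n. usc_map (mtopology_of (intrinsic_metric (X (enat n)))) (\<phi> n)"
            "usc_map (mtopology_of (intrinsic_metric (X \<infinity>))) \<phi>_inf"
          and lim: "\<forall>x\<in>X \<infinity>. \<forall>xs\<in>approx_seqs X x.
            limsup (\<lambda>n. ereal (\<phi> n (xs n))) \<le> ereal (\<phi>_inf x)"
        have lsc: "\<forall>n. lsc_map (mtopology_of (intrinsic_metric (X (enat n)))) (\<lambda>x. - \<phi> n x)"
            "lsc_map (mtopology_of (intrinsic_metric (X \<infinity>))) (\<lambda>x. - \<phi>_inf x)"
          using usc by (simp_all flip: usc_map_uminus)
        have "liminf (\<lambda>n. ereal (- \<phi> n (xs n))) = - limsup (\<lambda>n. ereal (\<phi> n (xs n)))" for xs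
          using ereal_Limsup_uminus[of sequentially "\<lambda>n. ereal (- \<phi> n (xs n))"]
          by (simp add: ereal_uminus_eq_reorder)
        then have lim': "\<forall>x\<in>X \<infinity>. \<forall>xs\<in>approx_seqs X x.
            ereal (- \<phi>_inf x) \<le> liminf (\<lambda>n. ereal (- \<phi> n (xs n)))"
          using lim by (simp flip: uminus_ereal.simps(1))
        have INF: "(INF y\<in>A. ereal (- f y)) = - (SUP y\<in>A. ereal (f y))" for A and f :: "'a \<Rightarrow> real"
          using ereal_INF_uminus_eq[of "\<lambda>y. ereal (f y)" A] by simp
        have liminf: "liminf (\<lambda>n. - g n) = - limsup g" for g :: "nat \<Rightarrow> ereal"
          using ereal_Limsup_uminus[of sequentially "\<lambda>n. - g n"] by (simp add: ereal_uminus_eq_reorder)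
        from hyp[rule_format, OF a as, of "\<lambda>n x. - \<phi> n x" "\<lambda>x. - \<phi>_inf x"] lsc lim'
        show "\<exists>\<delta>>0. \<forall>r. 0 < r \<longrightarrow> r < \<delta> \<longrightarrow>
            limsup (\<lambda>n. SUP y\<in>mcball_of (intrinsic_metric (X (enat n))) (as n) r. ereal (\<phi> n y))
              \<le> (SUP y\<in>mcball_of (intrinsic_metric (X \<infinity>)) a r. ereal (\<phi>_inf y))"
          by (simp add: INF liminf)
      qed
    qed
    then have "viscosity_subsolution (intrinsic_metric (X \<infinity>)) (?G \<infinity>)
        (\<lambda>x. - real_of_ereal (lower_semilimit X u x))"
      by (simp add: upper_semilimit_uminus)
    then show "viscosity_supersolution (intrinsic_metric (X \<infinity>)) (H \<infinity>)
           (\<lambda>x. real_of_ereal (lower_semilimit X u x))"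
      by (rule viscosity_subsolution_uminus[THEN iffD1])
  qed
qed

end
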